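(* For $f\in\mathcal{A}$ let $$D(f;z):=2\frac{zf'(z)}{f(z)}-\frac{z f''(z)}{f'(z)}.$$ Then $$\operatorname{Re}[D(f;z)]>0\qquad \text{for all } |z|<r_*$$ in each of the following cases: (i) $f\in \mathcal{U}$ and $r_*=r_1=0.839\ldots$ is the (unique real) root of the equation $r^{3}+2r^{2}-2=0$; (ii) $f\in \mathcal{S}^{\star}(1/2)$ and $r_*=r_2=\sqrt{\frac{\sqrt{5}-1}{2}}=0.78615\ldots$; (iii) $f\in \mathcal{G}$ and $r_*=r_3=\frac{2}{3}$; (iv) $f\in \mathcal{S}^{\star}$ and $r_*=r_4=\frac{1}{2}$; (v) $f\in \mathcal{S}$ and $r_*=r_5=\frac{1}{4}$.
   Context: Let $\mathbb{D}=\{z\in\mathbb{C}: |z|<1\}$ and let $\mathcal{A}$ be the family of all analytic functions $f$ in $\mathbb{D}$ with $f(0)=0$ and $f'(0)=1$. The following subclasses of $\mathcal{A}$ are used. - $\mathcal{S}$: the functions $f\in\mathcal{A}$ that are univalent (injective) in $\mathbb{D}$. - $\mathcal{S}^{\star}$: the starlike functions, i.e. $f\in\mathcal{A}$ with $\operatorname{Re}\frac{zf'(z)}{f(z)}>0$ for all $z\in\mathbb{D}$ (equivalently, $f$ is univalent and $f(\mathbb{D})$ is starlike with respect to $0$). - $\mathcal{S}^{\star}(1/2)$: the functions starlike of order $1/2$, i.e. $f\in\mathcal{A}$ with $\operatorname{Re}\frac{zf'(z)}{f(z)}>\frac12$ for all $z\in\mathbb{D}$. - $\mathcal{U}$: the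 functions $f\in\mathcal{A}$ satisfying $\left|\left(\frac{z}{f(z)}\right)^{2}f'(z)-1\right|<1$ for all $z\in\mathbb{D}$ (with $f(z)\ne 0$ for $z\neq 0$ implicit). - $\mathcal{G}$: the functions $f\in\mathcal{A}$ satisfying $\operatorname{Re}\left\{1+\frac{zf''(z)}{f'(z)}\right\}<\frac32$ for all $z\in\mathbb{D}$ (with $f'(z)\neq 0$ in $\mathbb{D}$ implicit). The quotients $z/f(z)$ and $zf'(z)/f(z)$ are understood at $z=0$ by their removable-singularity value $1$; in particular $D(f;0)=2$. *)

theory Defs
  imports "HOL-Complex_Analysis.Complex_Analysis"
begin

abbreviation unit_disc :: "complex set"  (\<open>\<bbbD>\<close>)
  where "\<bbbD> \<equiv> ball 0 1"

definition class_A :: "(complex \<Rightarrow> complex) set"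
  where "class_A = {f. f holomorphic_on \<bbbD> \<and> f 0 = 0 \<and> deriv f 0 = 1}"

text \<open>
  For \<open>f\<close> in \<open>class_A\<close> both quotients have a removable singularity with value \<open>1\<close>
  at the origin, which is filled in explicitly because \<open>0 / 0 = 0\<close> in HOL.
\<close>

definition z_over_f :: "(complex \<Rightarrow> complex) \<Rightarrow> complex \<Rightarrow> complex"
  where "z_over_f f z = (if z = 0 then 1 else z / f z)"

definition zf'_over_f :: "(complex \<Rightarrow> complex) \<Rightarrow> complex \<Rightarrow> complex"
  where "zf'_over_f f z = (if z = 0 then 1 else z * deriv f z / f z)"

definition class_S :: "(complex \<Rightarrow> complex) set"
  where "class_S = {f \<in> class_A. inj_on f \<bbbD>}"

text \<open>
  The nonvanishing conditions below say that the quotients are defined throughout the disc.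
  In \<open>class_G\<close> the condition is indispensable: a zero of \<open>deriv f\<close> would satisfy the
  inequality through the convention \<open>x / 0 = 0\<close>.
\<close>

definition class_starlike :: "(complex \<Rightarrow> complex) set"
  where "class_starlike = {f \<in> class_A.
    (\<forall>z\<in>\<bbbD> - {0}. f z \<noteq> 0) \<and> (\<forall>z\<in>\<bbbD>. Re (zf'_over_f f z) > 0)}"

definition class_starlike_half :: "(complex \<Rightarrow> complex) set"
  where "class_starlike_half = {f \<in> class_A.
    (\<forall>z\<in>\<bbbD> - {0}. f z \<noteq> 0) \<and> (\<forall>z\<in>\<bbbD>. Re (zf'_over_f f z) > 1/2)}"

definition class_U :: "(complex \<Rightarrow> complex) set"
  where "class_U = {f \<in> class_A.
    (\<forall>z\<in>\<bbbD> - {0}. f z \<noteq> 0) \<and> (\<forall>z\<in>\<bbbD>. norm ((z_over_f f z)\<^sup>2 * deriv f z - 1) < 1)}"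

definition class_G :: "(complex \<Rightarrow> complex) set"
  where "class_G = {f \<in> class_A.
    (\<forall>z\<in>\<bbbD>. deriv f z \<noteq> 0) \<and>
    (\<forall>z\<in>\<bbbD>. Re (1 + z * deriv (deriv f) z / deriv f z) < 3/2)}"

definition D :: "(complex \<Rightarrow> complex) \<Rightarrow> complex \<Rightarrow> complex"
  where "D f z = 2 * zf'_over_f f z - z * deriv (deriv f) z / deriv f z"

end

theory Submission
  imports Defs
begin

text \<open>
  Put \<open>q = f / (z f')\<close>. Then \<open>D f = 1 + (1 + z q') / q\<close>, and on \<open>|z| < 1\<close> the classes translate into
  half-plane or disc conditions on \<open>q\<close>, so that the Schwarz and Schwarz-Pick lemmas give the radii
  for \<open>S\<^sup>*(1/2)\<close> and \<open>S\<^sup>*\<close>. For the class U one uses \<open>D f = 2 - z \<omega>' / (1 + \<omega>)\<close> instead, where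
  \<open>\<omega> = (z / f)\<^sup>2 f' - 1\<close> vanishes to second order at \<open>0\<close>. For the class G a boundary-point argument in
  the manner of Jack's lemma yields \<open>Re q > 3/4\<close>, hence \<open>Re (z f' / f) \<ge> 1/2\<close> on \<open>|z| < 2/3\<close>, while
  \<open>Re (z f'' / f') < 1/2\<close> by hypothesis.

  For \<open>f\<close> univalent let \<open>F\<close> be the Koebe transform of \<open>f\<close> at \<open>z\<close> and \<open>g(w) = w / F(w)\<close>. With \<open>r = |z|\<close>,
  \<open>(1 - r\<^sup>2) D f(z) = 2 (1 - r\<^sup>2 + g(-z) - g(0) + g'(0) z)\<close>,
  so it suffices to bound the second order Taylor remainder of \<open>g\<close>. A covering theorem with a constant
  weaker than Koebe's \<open>1/4\<close> gives \<open>|g| \<le> 21/2\<close>, which is enough for \<open>r < 1/4\<close>; neither the area theorem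
  nor sharp distortion estimates are needed.
\<close>

section \<open>Schwarz and Schwarz-Pick lemmas\<close>

text \<open>The bound is non-strict in hypothesis and conclusion alike, so that the lemma applies
  again to \<open>h\<close> whenever \<open>h 0 = 0\<close>. The strict bound required by the usual
  Schwarz lemma comes from the maximum modulus principle: a value of modulus 1 would make
  \<open>f\<close> constant, against \<open>f 0 = 0\<close>.\<close>

lemma Schwarz_factor:
  assumes holf: "f holomorphic_on ball 0 1" and f0: "f 0 = 0"
    and le: "\<And>z. norm z < 1 \<Longrightarrow> norm (f z) \<le> 1"
  obtains h where "h holomorphic_on ball 0 1" "\<And>z. norm z < 1 \<Longrightarrow> f z = z * h z"
    "\<And>z. norm z < 1 \<Longrightarrow> norm (h z) \<le> 1" "h 0 = deriv f 0"
proof -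
  have less: "norm (f z) < 1" if "norm z < 1" for z
  proof (rule ccontr)
    assume "\<not> norm (f z) < 1"
    with le that have 1: "norm (f z) = 1"
      by force
    have "f constant_on ball 0 1"
      by (rule maximum_modulus_principle [where U = "ball 0 1" and \<xi> = z]) (use holf that le 1 in auto)
    then have "f z = f 0"
      using that by (force simp: constant_on_def)
    with f0 1 show False by simp
  qed
  obtain h where h: "h holomorphic_on ball 0 1" "\<And>z. norm z < 1 \<Longrightarrow> f z = z * h z" "deriv f 0 = h 0"
    using Schwarz3 [OF holf f0] by blast
  have "norm (h z) \<le> 1" if "norm z < 1" for z
  proof (cases "z = 0")
    case True
    then show ?thesis
      using Schwarz_Lemma(2) [OF holf f0 less, of 0] h(3) by simp
  next
    case False
    have "norm z * norm (h z) \<le> norm z * 1"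
      using Schwarz_Lemma(1) [OF holf f0 less that] h(2) [OF that] by (simp add: norm_mult)
    with False show ?thesis
      by simp
  qed
  with h that show thesis by simp
qed

lemma one_minus_cnj_mult_nonzero:
  assumes "norm a < 1" "norm b < 1"
  shows "1 - cnj a * b \<noteq> 0"
proof
  assume "1 - cnj a * b = 0"
  then have "norm (cnj a * b) = 1" by simp
  moreover have "norm (cnj a * b) < 1"
    using assms norm_mult_less [of "cnj a" 1 b 1] by simp
  ultimately show False by simp
qed

lemma Moebius_function_has_field_derivative:
  assumes "1 - cnj w * z \<noteq> 0"
  shows "(Moebius_function 0 w has_field_derivative (1 - (norm w)\<^sup>2) / (1 - cnj w * z)\<^sup>2) (at z)"
proof -
  have "((\<lambda>z. (z - w) / (1 - cnj w * z)) has_field_derivative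
      ((1 - cnj w * z) - (z - w) * (- cnj w)) / ((1 - cnj w * z) * (1 - cnj w * z))) (at z)"
    by (rule derivative_eq_intros refl | use assms in simp)+
  also have "(1 - cnj w * z) - (z - w) * (- cnj w) = 1 - complex_of_real ((norm w)\<^sup>2)"
    by (simp add: complex_norm_square algebra_simps del: of_real_power)
  finally show ?thesis
    by (simp add: Moebius_function_simple [abs_def] power2_eq_square)
qed

text \<open>Moebius maps that exchange \<open>a\<close> and \<open>f a\<close> for 0 reduce this to
  the derivative bound of the Schwarz lemma at 0. If some value has modulus 1, the map at
  \<open>f a\<close> degenerates, but then \<open>f\<close> is constant and its derivative
  vanishes.\<close>

lemma Schwarz_Pick:
  assumes holf: "f holomorphic_on ball 0 1"
    and le: "\<And>z. norm z < 1 \<Longrightarrow> norm (f z) \<le> 1" and a: "norm a < 1"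
  shows "norm (deriv f a) \<le> (1 - (norm (f a))\<^sup>2) / (1 - (norm a)\<^sup>2)"
proof (cases "\<exists>z\<in>ball 0 1. norm (f z) = 1")
  case True
  then obtain z where z: "norm z < 1" "norm (f z) = 1" by auto
  have "f constant_on ball 0 1"
    by (rule maximum_modulus_principle [where U = "ball 0 1" and \<xi> = z]) (use holf z le in auto)
  then obtain c where c: "\<And>z. norm z < 1 \<Longrightarrow> f z = c"
    unfolding constant_on_def by auto
  have "(f has_field_derivative 0) (at a)"
    by (rule has_field_derivative_transform_within_open [OF DERIV_const [of c], where S = "ball 0 1"])
       (use a c in auto)
  then have "deriv f a = 0" by (rule DERIV_imp_deriv)
  moreover have "0 \<le> 1 - (norm (f a))\<^sup>2" "0 \<le> 1 - (norm a)\<^sup>2"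
    using le [OF a] a by (auto simp: power_le_one abs_square_le_1)
  ultimately show ?thesis by simp
next
  case False
  then have less: "norm (f z) < 1" if "norm z < 1" for z
    using le [OF that] that by (force simp: less_le)
  define g where "g = Moebius_function 0 (f a) \<circ> f \<circ> Moebius_function 0 (- a)"
  have M: "norm (Moebius_function 0 (- a) z) < 1" if "norm z < 1" for z
    using Moebius_function_norm_lt_1 [of "- a" z 0] a that by simp
  have fM: "norm (f (Moebius_function 0 (- a) z)) < 1" if "norm z < 1" for z
    using less M that by blast
  have "g holomorphic_on ball 0 1"
    unfolding g_def
  proof (intro holomorphic_on_compose)
    show "Moebius_function 0 (- a) holomorphic_on ball 0 1"
      using Moebius_function_holomorphic [of "- a"] a by simp
    show "f holomorphic_on Moebius_function 0 (- a) ` ball 0 1"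
      by (rule holomorphic_on_subset [OF holf]) (use M in auto)
    show "Moebius_function 0 (f a) holomorphic_on f ` Moebius_function 0 (- a) ` ball 0 1"
      by (rule holomorphic_on_subset [OF Moebius_function_holomorphic]) (use less [OF a] fM in auto)
  qed
  moreover have M0: "Moebius_function 0 (- a) 0 = a"
    by (simp add: Moebius_function_simple)
  then have "g 0 = 0"
    by (simp add: g_def Moebius_function_eq_zero)
  moreover have "norm (g z) < 1" if "norm z < 1" for z
    unfolding g_def using Moebius_function_norm_lt_1 [OF less [OF a] fM [OF that]] by simp
  ultimately have "norm (deriv g 0) \<le> 1"
    using Schwarz_Lemma(2) [of g 0] by simp
  moreover have "deriv g 0 = (1 - (norm (f a))\<^sup>2) / (1 - cnj (f a) * f a)\<^sup>2 * (deriv f a * (1 - (norm a)\<^sup>2))"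
  proof -
    have d1: "(Moebius_function 0 (- a) has_field_derivative (1 - (norm a)\<^sup>2)) (at 0)"
      using Moebius_function_has_field_derivative [of "- a" 0] by simp
    have d2: "(f has_field_derivative deriv f a) (at a)"
      using holf a by (simp add: holomorphic_derivI)
    have d3: "(Moebius_function 0 (f a) has_field_derivative (1 - (norm (f a))\<^sup>2) / (1 - cnj (f a) * f a)\<^sup>2) (at (f a))"
      by (rule Moebius_function_has_field_derivative, rule one_minus_cnj_mult_nonzero)
         (use less [OF a] in auto)
    have "((Moebius_function 0 (f a) \<circ> (f \<circ> Moebius_function 0 (- a))) has_field_derivative
      (1 - (norm (f a))\<^sup>2) / (1 - cnj (f a) * f a)\<^sup>2 * (deriv f a * (1 - (norm a)\<^sup>2))) (at 0)"
      by (intro DERIV_chain) (use d1 d2 d3 M0 in auto)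
    then show ?thesis
      by (simp add: g_def o_assoc DERIV_imp_deriv)
  qed
  moreover have "1 - cnj (f a) * f a = of_real (1 - (norm (f a))\<^sup>2)"
    by (simp add: complex_norm_square mult.commute del: of_real_power)
  ultimately have *: "norm (complex_of_real (1 - (norm (f a))\<^sup>2) / (of_real (1 - (norm (f a))\<^sup>2))\<^sup>2 *
      (deriv f a * of_real (1 - (norm a)\<^sup>2))) \<le> 1"
    by metis
  have pos: "0 < 1 - (norm (f a))\<^sup>2" "0 < 1 - (norm a)\<^sup>2"
    using less [OF a] a by (auto simp: abs_square_less_1)
  have "(1 - (norm (f a))\<^sup>2) / (1 - (norm (f a))\<^sup>2)\<^sup>2 * (norm (deriv f a) * (1 - (norm a)\<^sup>2)) \<le> 1"
    using * pos unfolding norm_mult norm_divide norm_power norm_of_real by simp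
  with pos show ?thesis
    by (simp add: divide_simps power2_eq_square mult.commute)
qed

text \<open>The Cayley map \<open>w \<mapsto> (w - f 0) / (w + cnj (f 0))\<close> takes the right
  half-plane into the disc, because the squared moduli of denominator and numerator differ by
  \<open>4 * Re w * Re (f 0)\<close>. Its derivative at \<open>f 0\<close> is
  \<open>1 / (2 * Re (f 0))\<close>, and the Schwarz lemma applies.\<close>

lemma halfplane_deriv_bound:
  assumes holf: "f holomorphic_on ball 0 1" and pos: "\<And>z. norm z < 1 \<Longrightarrow> Re (f z) > 0"
  shows "norm (deriv f 0) \<le> 2 * Re (f 0)"
proof -
  define g where "g = (\<lambda>z. (f z - f 0) / (f z + cnj (f 0)))"
  have p0: "Re (f 0) > 0" using pos by simp
  have nz: "f z + cnj (f 0) \<noteq> 0" if "norm z < 1" for z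
  proof
    assume "f z + cnj (f 0) = 0"
    then have "Re (f z + cnj (f 0)) = 0" by simp
    with pos [OF that] p0 show False by simp
  qed
  have "g holomorphic_on ball 0 1"
    unfolding g_def by (intro holomorphic_intros holf) (use nz in auto)
  moreover have "norm (g z) < 1" if "norm z < 1" for z
  proof -
    have "(norm (f z - f 0))\<^sup>2 < (norm (f z + cnj (f 0)))\<^sup>2"
      using mult_pos_pos [OF pos [OF that] p0] unfolding cmod_power2
      by (simp add: power2_eq_square algebra_simps)
    then show ?thesis
      using nz [OF that] by (simp add: g_def norm_divide power2_less_imp_less)
  qed
  ultimately have "norm (deriv g 0) \<le> 1"
    using Schwarz_Lemma(2) [of g 0] by (simp add: g_def)
  moreover have "(g has_field_derivative deriv f 0 / (2 * Re (f 0))) (at 0)"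
  proof -
    have d: "(f has_field_derivative deriv f 0) (at 0)"
      using holf by (simp add: holomorphic_derivI)
    have "(g has_field_derivative (deriv f 0 * (f 0 + cnj (f 0)) - (f 0 - f 0) * deriv f 0) /
       ((f 0 + cnj (f 0)) * (f 0 + cnj (f 0)))) (at 0)"
      unfolding g_def by (rule derivative_eq_intros d refl | use nz [of 0] in simp)+
    then show ?thesis
      using nz [of 0] by (simp add: complex_add_cnj)
  qed
  then have "deriv g 0 = deriv f 0 / (2 * Re (f 0))" by (rule DERIV_imp_deriv)
  ultimately show ?thesis
    using p0 by (simp add: norm_divide norm_mult divide_simps)
qed

section \<open>The functional \<open>D\<close> on the class of normalized functions\<close>

text \<open>Dividing out the zero of \<open>f\<close> at the origin gives formulas for both
  quotients that hold at 0 as well, so later arguments need no case distinction there.\<close>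

lemma class_A_factor:
  assumes "f \<in> class_A"
  obtains k where "k holomorphic_on ball 0 1" "k 0 = 1"
    "\<And>z. norm z < 1 \<Longrightarrow> f z = z * k z"
    "\<And>z. norm z < 1 \<Longrightarrow> deriv f z = k z + z * deriv k z"
    "\<And>z. norm z < 1 \<Longrightarrow> zf'_over_f f z = deriv f z / k z"
    "\<And>z. norm z < 1 \<Longrightarrow> z_over_f f z = 1 / k z"
    "deriv (deriv f) 0 = 2 * deriv k 0"
proof -
  have holf: "f holomorphic_on ball 0 1" and f0: "f 0 = 0" and f'0: "deriv f 0 = 1"
    using assms by (auto simp: class_A_def)
  obtain k where k: "k holomorphic_on ball 0 1" "\<And>z. norm z < 1 \<Longrightarrow> f z = z * k z" "deriv f 0 = k 0"
    using Schwarz3 [OF holf f0] by blast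
  have dk: "(k has_field_derivative deriv k z) (at z)" if "norm z < 1" for z
    using k(1) that by (simp add: holomorphic_derivI)
  have df: "deriv f z = k z + z * deriv k z" if "norm z < 1" for z
  proof -
    have "((\<lambda>z. z * k z) has_field_derivative k z + z * deriv k z) (at z)"
      by (rule derivative_eq_intros dk [OF that] refl | simp)+
    then have "(f has_field_derivative k z + z * deriv k z) (at z)"
      by (rule has_field_derivative_transform_within_open [where S = "ball 0 1"]) (use that k(2) in auto)
    then show ?thesis by (rule DERIV_imp_deriv)
  qed
  have "(deriv k has_field_derivative deriv (deriv k) 0) (at 0)"
    by (rule holomorphic_derivI [OF holomorphic_deriv [OF k(1)]]) auto
  then have "((\<lambda>z. k z + z * deriv k z) has_field_derivative 2 * deriv k 0) (at 0)"
    by (auto intro!: derivative_eq_intros dk)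
  then have "(deriv f has_field_derivative 2 * deriv k 0) (at 0)"
    by (rule has_field_derivative_transform_within_open [where S = "ball 0 1"]) (use df in auto)
  then have "deriv (deriv f) 0 = 2 * deriv k 0" by (rule DERIV_imp_deriv)
  then show thesis
    using that [OF k(1) _ k(2) df] k f'0
    by (auto simp: zf'_over_f_def z_over_f_def)
qed

text \<open>The reciprocal of \<open>z f' / f\<close> is \<open>q = k / f'\<close>, which is
  holomorphic as soon as \<open>f'\<close> has no zero. Differentiating \<open>q * f' = k\<close>
  and inserting \<open>z * k' = f' - k\<close> gives the identity for
  \<open>1 + z f'' / f'\<close>.\<close>

lemma D_eq_reciprocal_quotient:
  assumes "f \<in> class_A" and "\<And>z. norm z < 1 \<Longrightarrow> deriv f z \<noteq> 0"
  obtains q where "q holomorphic_on ball 0 1" "q 0 = 1"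
    "\<And>z. norm z < 1 \<Longrightarrow> zf'_over_f f z = 1 / q z"
    "\<And>z. norm z < 1 \<Longrightarrow> q z * (1 + z * deriv (deriv f) z / deriv f z) = 1 - z * deriv q z"
    "\<And>z. norm z < 1 \<Longrightarrow> q z \<noteq> 0 \<Longrightarrow> D f z = 1 + (1 + z * deriv q z) / q z"
proof -
  obtain k where k: "k holomorphic_on ball 0 1" "k 0 = 1"
    "\<And>z. norm z < 1 \<Longrightarrow> deriv f z = k z + z * deriv k z"
    "\<And>z. norm z < 1 \<Longrightarrow> zf'_over_f f z = deriv f z / k z"
    using class_A_factor [OF assms(1)] by metis
  have holf: "f holomorphic_on ball 0 1" and f'0: "deriv f 0 = 1"
    using assms by (auto simp: class_A_def)
  define q where "q = (\<lambda>z. k z / deriv f z)"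
  have holq: "q holomorphic_on ball 0 1"
    unfolding q_def by (intro holomorphic_intros k holomorphic_deriv [OF holf]) (use assms in auto)
  have zf': "zf'_over_f f z = 1 / q z" if "norm z < 1" for z
    using k(4) [OF that] by (simp add: q_def)
  have key: "q z * (1 + z * deriv (deriv f) z / deriv f z) = 1 - z * deriv q z" if z: "norm z < 1" for z
  proof -
    have dk: "(k has_field_derivative deriv k z) (at z)"
      using k(1) z by (simp add: holomorphic_derivI)
    have df: "(deriv f has_field_derivative deriv (deriv f) z) (at z)"
      by (rule holomorphic_derivI [OF holomorphic_deriv [OF holf]]) (use z in auto)
    have nz: "deriv f z \<noteq> 0" using assms z by blast
    have "(q has_field_derivative (deriv k z * deriv f z - k z * deriv (deriv f) z) / (deriv f z * deriv f z)) (at z)"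
      unfolding q_def by (rule derivative_eq_intros dk df nz refl)+
    then have "deriv q z = (deriv k z * deriv f z - k z * deriv (deriv f) z) / (deriv f z * deriv f z)"
      by (rule DERIV_imp_deriv)
    then have "z * deriv q z = (z * deriv k z * deriv f z - z * k z * deriv (deriv f) z) / (deriv f z * deriv f z)"
      by (simp add: algebra_simps)
    moreover have "z * deriv k z = deriv f z - k z"
      using k(3) [OF z] by simp
    ultimately show ?thesis
      using nz by (simp add: q_def field_simps)
  qed
  have "D f z = 1 + (1 + z * deriv q z) / q z" if z: "norm z < 1" and nz: "q z \<noteq> 0" for z
  proof -
    have "z * deriv (deriv f) z / deriv f z = (1 - z * deriv q z) / q z - 1"
      using key [OF z] nz by (simp add: field_simps)
    then show ?thesis
      unfolding D_def zf' [OF z] using nz by (simp add: field_simps)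
  qed
  then show thesis
    using that [OF holq _ zf' key] k(2) f'0 by (simp add: q_def)
qed

section \<open>The class U\<close>

text \<open>The sign is that of \<open>Re ((1 + u) * cnj (1 + v))\<close>, twice which is the
  squared modulus of \<open>1 + u + v\<close> plus the positive defect in the hypothesis. This
  replaces an estimate of the arguments of \<open>1 + u\<close> and \<open>1 + v\<close>.\<close>

lemma Re_quotient_pos:
  fixes u v :: complex
  assumes "(norm u)\<^sup>2 + (norm v)\<^sup>2 < 1"
  shows "Re ((1 + u) / (1 + v)) > 0"
proof -
  have "v \<noteq> -1"
  proof
    assume "v = -1"
    with assms show False by simp
  qed
  then have "1 + v \<noteq> 0"
    by (metis add_eq_0_iff)
  moreover have "2 * Re ((1 + u) * cnj (1 + v)) =
      (1 + Re u + Re v)\<^sup>2 + (Im u + Im v)\<^sup>2 + (1 - (norm u)\<^sup>2 - (norm v)\<^sup>2)"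
    unfolding cmod_power2 by (simp add: power2_eq_square algebra_simps)
  then have "Re ((1 + u) * cnj (1 + v)) > 0"
    using assms by (smt (verit) zero_le_power2)
  ultimately show ?thesis
    by (simp add: Re_complex_div_gt_0)
qed

lemma cubic_root:
  obtains r1 :: real where "\<And>r::real. r^3 + 2 * r^2 - 2 = 0 \<longleftrightarrow> r = r1" "0.839 \<le> r1" "r1 < 0.840"
    "\<And>r::real. 0 \<le> r \<Longrightarrow> r < r1 \<Longrightarrow> r^3 + 2 * r^2 < 2"
proof -
  have "\<exists>x::real. 0.839 \<le> x \<and> x \<le> 0.840 \<and> x^3 + 2 * x^2 - 2 = 0"
    by (rule IVT') (auto intro!: continuous_intros simp: power3_eq_cube power2_eq_square)
  then obtain r1 :: real where r1: "0.839 \<le> r1" "r1 \<le> 0.840" "r1^3 + 2 * r1^2 = 2"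
    by auto
  have "r1 \<noteq> 0.840"
  proof
    assume "r1 = 0.840"
    with r1(3) have "(0.840::real)^3 + 2 * 0.840^2 = 2" by metis
    then show False by (simp add: power3_eq_cube power2_eq_square)
  qed
  have less: "x^3 + 2 * x^2 < y^3 + 2 * y^2" if "0 \<le> x" "x < y" for x y :: real
    using power_strict_mono [of x y 3] power_strict_mono [of x y 2] that by simp
  have neg: "x^3 + 2 * x^2 < 2" if "x < 0" for x :: real
  proof (cases "x \<le> -2")
    case True
    then have "x\<^sup>2 * (x + 2) \<le> 0" by (simp add: mult_nonneg_nonpos)
    then show ?thesis by (simp add: power3_eq_cube power2_eq_square algebra_simps)
  next
    case False
    \<comment> \<open>The local maximum of \<open>x^3 + 2 * x^2\<close> lies at \<open>-4/3\<close>
      and has the value \<open>32/27 < 2\<close>; hence the double zero there.\<close>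
    have "0 \<le> (x + 4/3)\<^sup>2 * (2/3 - x)"
      using that by simp
    also have "\<dots> = 32/27 - (x^3 + 2 * x^2)"
      by (simp add: power3_eq_cube power2_eq_square field_simps)
    finally show ?thesis by simp
  qed
  have "r^3 + 2 * r^2 - 2 = 0 \<longleftrightarrow> r = r1" for r :: real
  proof -
    have "0 \<le> r1" using r1 by simp
    then consider "r < 0" | "0 \<le> r" "r < r1" | "r = r1" | "r1 < r" by linarith
    then show ?thesis
      by cases (use less [of r r1] less [of r1 r] neg [of r] r1(3) \<open>0 \<le> r1\<close> in auto)
  qed
  then show thesis
    using that [of r1] r1 \<open>r1 \<noteq> 0.840\<close> less [of _ r1] by force
qed

text \<open>Since \<open>w = z^2 * h\<close> with \<open>h\<close> bounded by 1,
  \<open>D f z\<close> is twice a quotient as in \<open>Re_quotient_pos\<close>, with numerator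
  \<open>1 - z^3 * h' / 2\<close>. Schwarz-Pick bounds the perturbation by
  \<open>c * (1 - t)\<close>, where \<open>t\<close> is the squared modulus of \<open>h z\<close>;
  the cubic inequality for \<open>norm z\<close> is precisely \<open>c < 1\<close>.\<close>

lemma class_U_Re_D_pos:
  assumes "f \<in> class_U" and z: "norm z < 1" "norm z ^ 3 + 2 * norm z ^ 2 < 2"
  shows "Re (D f z) > 0"
proof -
  have A: "f \<in> class_A" and fnz: "\<And>z. norm z < 1 \<Longrightarrow> z \<noteq> 0 \<Longrightarrow> f z \<noteq> 0"
    and U: "\<And>z. norm z < 1 \<Longrightarrow> norm ((z_over_f f z)\<^sup>2 * deriv f z - 1) < 1"
    using assms(1) by (auto simp: class_U_def)
  obtain k where k: "k holomorphic_on ball 0 1" "k 0 = 1" "\<And>z. norm z < 1 \<Longrightarrow> f z = z * k z"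
    "\<And>z. norm z < 1 \<Longrightarrow> deriv f z = k z + z * deriv k z"
    "\<And>z. norm z < 1 \<Longrightarrow> zf'_over_f f z = deriv f z / k z"
    "\<And>z. norm z < 1 \<Longrightarrow> z_over_f f z = 1 / k z"
    "deriv (deriv f) 0 = 2 * deriv k 0"
    using class_A_factor [OF A] by metis
  have holf: "f holomorphic_on ball 0 1" and f'0: "deriv f 0 = 1"
    using A by (auto simp: class_A_def)
  have knz: "k z \<noteq> 0" if "norm z < 1" for z
    using fnz [OF that] k(2,3) that by (cases "z = 0") auto
  define w where "w = (\<lambda>z. deriv f z / (k z)\<^sup>2 - 1)"
  have wle: "norm (w z) < 1" if "norm z < 1" for z
    using U [OF that] k(6) [OF that] by (simp add: w_def power_divide)
  have holw: "w holomorphic_on ball 0 1"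
    unfolding w_def by (intro holomorphic_intros k holomorphic_deriv [OF holf]) (use knz in auto)
  have w0: "w 0 = 0" by (simp add: w_def f'0 k)
  have dw: "deriv w z = deriv (deriv f) z / (k z)\<^sup>2 - 2 * deriv f z * deriv k z / (k z)^3"
    if z: "norm z < 1" for z
  proof -
    have dk: "(k has_field_derivative deriv k z) (at z)"
      using k(1) z by (simp add: holomorphic_derivI)
    have df: "(deriv f has_field_derivative deriv (deriv f) z) (at z)"
      by (rule holomorphic_derivI [OF holomorphic_deriv [OF holf]]) (use z in auto)
    have "(w has_field_derivative (deriv (deriv f) z * (k z)\<^sup>2 - deriv f z * (2 * k z * deriv k z)) / ((k z)\<^sup>2 * (k z)\<^sup>2)) (at z)"
      unfolding w_def by (rule derivative_eq_intros dk df refl | use knz [OF z] in simp)+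
    then show ?thesis
      using knz [OF z] by (simp add: DERIV_imp_deriv field_simps power3_eq_cube power2_eq_square)
  qed
  \<comment> \<open>The terms \<open>f''(0)\<close> and \<open>2 * k'(0)\<close> cancel, so
    \<open>Schwarz_factor\<close> applies twice: to \<open>w\<close> and then to
    \<open>w / z\<close>.\<close>
  have "deriv w 0 = 0"
    using dw [of 0] k f'0 by simp
  obtain g where g: "g holomorphic_on ball 0 1" "\<And>z. norm z < 1 \<Longrightarrow> w z = z * g z"
    "\<And>z. norm z < 1 \<Longrightarrow> norm (g z) \<le> 1" "g 0 = deriv w 0"
    using Schwarz_factor [OF holw w0] wle less_imp_le by metis
  then obtain h where h: "h holomorphic_on ball 0 1" "\<And>z. norm z < 1 \<Longrightarrow> g z = z * h z"
    "\<And>z. norm z < 1 \<Longrightarrow> norm (h z) \<le> 1"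
    using Schwarz_factor [OF g(1)] \<open>deriv w 0 = 0\<close> by metis
  have wh: "w z = z\<^sup>2 * h z" if "norm z < 1" for z
    using g(2) h(2) that by (simp add: power2_eq_square)
  have "((\<lambda>z. z\<^sup>2 * h z) has_field_derivative 2 * z * h z + z\<^sup>2 * deriv h z) (at z)"
    using holomorphic_derivI [OF h(1), of z] z by (auto intro!: derivative_eq_intros)
  then have "(w has_field_derivative 2 * z * h z + z\<^sup>2 * deriv h z) (at z)"
    by (rule has_field_derivative_transform_within_open [where S = "ball 0 1"]) (use wh z in auto)
  then have dwh: "deriv w z = 2 * z * h z + z\<^sup>2 * deriv h z" by (rule DERIV_imp_deriv)
  have f'nz: "deriv f z \<noteq> 0"
    using wle [OF z(1)] by (auto simp: w_def)
  have w1: "1 + w z \<noteq> 0"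
    using f'nz knz [OF z(1)] by (simp add: w_def)
  have zk: "z * deriv k z = deriv f z - k z"
    using k(4) [OF z(1)] by simp
  \<comment> \<open>Up to clearing denominators this is the logarithmic derivative of
    \<open>1 + w = f' / k^2\<close>: \<open>z w' / (1 + w) = z f'' / f' - 2 z k' / k\<close>, where
    \<open>z k' / k = f' / k - 1\<close>.\<close>
  have "z * deriv w z * (k z)^3 * deriv f z = (k z * (z * deriv (deriv f) z) - 2 * deriv f z * (z * deriv k z)) * deriv f z"
    unfolding dw [OF z(1)] using knz [OF z(1)] by (simp add: field_simps power3_eq_cube power2_eq_square)
  then have "D f z = 2 - z * deriv w z / (1 + w z)"
    unfolding D_def k(5) [OF z(1)] zk using knz [OF z(1)] f'nz
    by (simp add: w_def field_simps power3_eq_cube power2_eq_square)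
  also have "\<dots> = (2 + 2 * w z - z * deriv w z) / (1 + w z)"
    using w1 by (simp add: field_simps)
  also have "\<dots> = 2 * ((1 + - (z^3 * deriv h z / 2)) / (1 + w z))"
  proof -
    have "2 + 2 * w z - z * deriv w z = 2 * (1 + - (z^3 * deriv h z / 2))"
      unfolding dwh wh [OF z(1)] by (simp add: algebra_simps power3_eq_cube power2_eq_square)
    then show ?thesis by simp
  qed
  finally have D: "D f z = 2 * ((1 + - (z^3 * deriv h z / 2)) / (1 + w z))" .
  have "(norm (- (z^3 * deriv h z / 2)))\<^sup>2 + (norm (w z))\<^sup>2 < 1"
  proof -
    define r t where "r = norm z" and "t = (norm (h z))\<^sup>2"
    define c where "c = r^3 / (2 * (1 - r\<^sup>2))"
    have r: "0 \<le> r" "r < 1" "r\<^sup>2 < 1" using z by (auto simp: r_def power_less_one_iff)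
    have t: "0 \<le> t" "t \<le> 1" using h(3) [OF z(1)] by (auto simp: t_def power_le_one)
    have c: "0 \<le> c" "c < 1" using r z by (auto simp: c_def r_def field_simps)
    have "norm (deriv h z) \<le> (1 - t) / (1 - r\<^sup>2)"
      using Schwarz_Pick [OF h(1,3) z(1)] by (simp add: t_def r_def)
    then have "r^3 * norm (deriv h z) / 2 \<le> r^3 * ((1 - t) / (1 - r\<^sup>2)) / 2"
      using r by (intro divide_right_mono mult_left_mono) auto
    also have "\<dots> = c * (1 - t)"
      by (simp add: c_def)
    finally have "norm (- (z^3 * deriv h z / 2)) \<le> c * (1 - t)"
      by (simp add: norm_mult norm_divide norm_power r_def)
    then have "(norm (- (z^3 * deriv h z / 2)))\<^sup>2 \<le> (c * (1 - t))\<^sup>2"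
      by (intro power_mono) auto
    \<comment> \<open>One of the two factors \<open>1 - t\<close> is given away, which leaves a
      bound affine in \<open>t\<close>. The final sum is then a convex combination of
      \<open>c^2\<close> and \<open>r^4\<close>, both below 1.\<close>
    also have "\<dots> = (c\<^sup>2 * (1 - t)) * (1 - t)"
      by (simp add: power2_eq_square)
    also have "\<dots> \<le> c\<^sup>2 * (1 - t)"
      using t c by (intro mult_left_le) auto
    finally have 1: "(norm (- (z^3 * deriv h z / 2)))\<^sup>2 \<le> c\<^sup>2 * (1 - t)" .
    have 2: "(norm (w z))\<^sup>2 = r^4 * t"
      by (simp add: wh [OF z(1)] norm_mult norm_power r_def t_def power_mult_distrib)
    have c2: "c\<^sup>2 < 1" and r4: "r^4 < 1"
      using c r by (auto simp: power_less_one_iff)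
    have "c\<^sup>2 * (1 - t) + r^4 * t < 1"
    proof (cases "t = 1")
      case False
      then have "c\<^sup>2 * (1 - t) < 1 * (1 - t)"
        using c2 t by (intro mult_strict_right_mono) auto
      moreover have "r^4 * t \<le> 1 * t"
        using r4 t by (intro mult_right_mono) auto
      ultimately show ?thesis by simp
    qed (use r4 in simp)
    with 1 2 show ?thesis by simp
  qed
  from Re_quotient_pos [OF this] have "2 * Re ((1 + - (z^3 * deriv h z / 2)) / (1 + w z)) > 0"
    by (rule mult_pos_pos [rotated]) simp
  also have "2 * Re ((1 + - (z^3 * deriv h z / 2)) / (1 + w z)) = Re (D f z)"
    unfolding D times_complex.sel by (simp only: complex_Re_numeral complex_Im_numeral mult_zero_left diff_zero)
  finally show ?thesis .
qed

section \<open>Starlike functions\<close>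

text \<open>\<open>Re (1 / q) > 1/2\<close> describes the disc of radius 1 about 1, so
  \<open>q = 1 - z * h\<close> with \<open>h\<close> bounded by 1, and
  \<open>D f z = 2 - z^2 * h' / (1 - z * h)\<close>. Schwarz-Pick bounds the fraction in terms of
  the modulus \<open>t\<close> of \<open>h z\<close>, and the worst \<open>t\<close> leads to the
  golden-ratio condition \<open>Q^2 + Q < 1\<close> for \<open>Q = r^2\<close>.\<close>

lemma class_starlike_half_Re_D_pos:
  assumes "f \<in> class_starlike_half" and z: "norm z < sqrt ((sqrt 5 - 1) / 2)"
  shows "Re (D f z) > 0"
proof -
  have A: "f \<in> class_A" and half: "\<And>z. norm z < 1 \<Longrightarrow> Re (zf'_over_f f z) > 1/2"
    using assms(1) by (auto simp: class_starlike_half_def)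
  have f'nz: "deriv f z \<noteq> 0" if "norm z < 1" for z
    using half [OF that] A by (cases "z = 0") (auto simp: zf'_over_f_def class_A_def)
  obtain q where q: "q holomorphic_on ball 0 1" "q 0 = 1"
    "\<And>z. norm z < 1 \<Longrightarrow> zf'_over_f f z = 1 / q z"
    "\<And>z. norm z < 1 \<Longrightarrow> q z \<noteq> 0 \<Longrightarrow> D f z = 1 + (1 + z * deriv q z) / q z"
    using D_eq_reciprocal_quotient [OF A f'nz] by metis
  have qnz: "q z \<noteq> 0" if "norm z < 1" for z
    using half [OF that] q(3) [OF that] by auto
  have q1: "norm (1 - q z) < 1" if "norm z < 1" for z
  proof -
    have "1/2 < Re (1 / q z)" using half [OF that] q(3) [OF that] by simp
    also have "\<dots> = Re (q z) / (norm (q z))\<^sup>2"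
      by (simp add: Re_divide cmod_power2)
    finally have "(norm (q z))\<^sup>2 < 2 * Re (q z)"
      using qnz [OF that] by (simp add: field_simps)
    moreover have "(norm (1 - q z))\<^sup>2 = 1 - 2 * Re (q z) + (norm (q z))\<^sup>2"
      unfolding cmod_power2 by (simp add: power2_eq_square algebra_simps)
    ultimately have "(norm (1 - q z))\<^sup>2 < 1"
      by simp
    then show ?thesis
      by (simp add: abs_square_less_1)
  qed
  obtain h where h: "h holomorphic_on ball 0 1" "\<And>z. norm z < 1 \<Longrightarrow> 1 - q z = z * h z"
    "\<And>z. norm z < 1 \<Longrightarrow> norm (h z) \<le> 1"
    by (rule Schwarz_factor [of "\<lambda>z. 1 - q z"])
       (use q(1,2) q1 in \<open>auto intro!: holomorphic_intros less_imp_le\<close>)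
  define r t Q where "r = norm z" and "t = norm (h z)" and "Q = (norm z)\<^sup>2"
  have Q: "Q < (sqrt 5 - 1) / 2"
    using power_strict_mono [OF z, of 2] by (simp add: Q_def)
  have s5: "(sqrt 5)\<^sup>2 = (5::real)" "sqrt 5 < 3" "0 \<le> sqrt 5"
    by (auto simp: real_less_lsqrt)
  have Q0: "0 \<le> Q" "Q < 1" using Q s5 by (auto simp: Q_def)
  have QQ: "Q\<^sup>2 + Q < 1"
  proof -
    have "(Q + 1/2)\<^sup>2 < (sqrt 5 / 2)\<^sup>2"
      using Q Q0 by (intro power_strict_mono) auto
    then show ?thesis
      using s5(1) by (simp add: power2_eq_square algebra_simps)
  qed
  have z1: "norm z < 1"
    using Q0(2) by (simp add: Q_def abs_square_less_1)
  have qh: "q z = 1 - z * h z" if "norm z < 1" for z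
    using h(2) [OF that] by (simp add: algebra_simps)
  have "((\<lambda>z. 1 - z * h z) has_field_derivative - h z - z * deriv h z) (at z)"
    using holomorphic_derivI [OF h(1), of z] z1 by (auto intro!: derivative_eq_intros)
  then have "(q has_field_derivative - h z - z * deriv h z) (at z)"
    by (rule has_field_derivative_transform_within_open [where S = "ball 0 1"]) (use qh z1 in auto)
  then have dq: "deriv q z = - h z - z * deriv h z" by (rule DERIV_imp_deriv)
  have nz: "1 - z * h z \<noteq> 0"
    using qnz [OF z1] qh [OF z1] by simp
  have D: "D f z = 2 - z\<^sup>2 * deriv h z / (1 - z * h z)"
    unfolding q(4) [OF z1 qnz [OF z1]] qh [OF z1] dq using nz
    by (simp add: field_simps power2_eq_square)
  have rt: "0 \<le> r" "r < 1" "0 \<le> t" "t \<le> 1" "r\<^sup>2 = Q"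
    using z1 h(3) [OF z1] by (auto simp: r_def t_def Q_def)
  have rt1: "r * t < 1"
    using rt by (metis mult_left_le order.strict_trans1)
  have n1: "norm (1 - z * h z) \<ge> 1 - r * t"
    using norm_triangle_ineq2 [of 1 "z * h z"] by (simp add: norm_mult r_def t_def)
  have n2: "norm (deriv h z) \<le> (1 - t\<^sup>2) / (1 - Q)"
    using Schwarz_Pick [OF h(1,3) z1] by (simp add: t_def Q_def)
  have "norm (z\<^sup>2 * deriv h z / (1 - z * h z)) = Q * norm (deriv h z) / norm (1 - z * h z)"
    by (simp add: norm_mult norm_divide norm_power Q_def)
  also have "\<dots> \<le> Q * ((1 - t\<^sup>2) / (1 - Q)) / (1 - r * t)"
    by (intro frac_le mult_left_mono n1 n2) (use rt1 Q0 rt in \<open>auto simp: power_le_one\<close>)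
  also have "\<dots> < 2"
  proof -
    \<comment> \<open>This quadratic in \<open>t\<close> is the gap in the inequality wanted after
      clearing denominators. Completing the square shows that its minimum over all real
      \<open>t\<close> is \<open>1 - Q - Q^2\<close>.\<close>
    have "0 < Q * t\<^sup>2 - 2 * (1 - Q) * (r * t) + 2 - 3 * Q"
    proof (cases "Q = 0")
      case True
      then have "r = 0" using rt by simp
      then show ?thesis using True by simp
    next
      case False
      then have Qp: "0 < Q" using Q0 by simp
      have "Q * (Q * t\<^sup>2 - 2 * (1 - Q) * (r * t) + 2 - 3 * Q)
         = (Q * t - (1 - Q) * r)\<^sup>2 + Q * (1 - Q - Q\<^sup>2)"
        unfolding rt(5) [symmetric] by (simp add: power2_eq_square algebra_simps)
      also have "\<dots> > 0"
        using QQ Qp by (intro add_nonneg_pos mult_pos_pos) auto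
      finally show ?thesis using Qp by (simp add: zero_less_mult_iff)
    qed
    then have "Q * (1 - t\<^sup>2) < 2 * ((1 - Q) * (1 - r * t))"
      by (simp add: algebra_simps)
    then show ?thesis
      using Q0 rt1 by (simp add: divide_simps mult.commute)
  qed
  finally have "Re (z\<^sup>2 * deriv h z / (1 - z * h z)) < 2"
    by (meson complex_Re_le_cmod order_le_less_trans)
  then show ?thesis by (simp add: D)
qed

text \<open>In \<open>D f = 1 + 1 / q + z q' / q\<close> the Cayley transform \<open>w\<close> of
  \<open>q\<close> fixes 0. Thus \<open>Re (1 / q)\<close> is at least
  \<open>(1 - r) / (1 + r)\<close>, while \<open>z q' / q\<close> has modulus at most
  \<open>2 r / (1 - r^2)\<close>; the total \<open>2 (1 - 2 r) / (1 - r^2)\<close> is positive for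
  \<open>r < 1/2\<close>.\<close>

lemma class_starlike_Re_D_pos:
  assumes "f \<in> class_starlike" and z: "norm z < 1/2"
  shows "Re (D f z) > 0"
proof -
  have A: "f \<in> class_A" and star: "\<And>z. norm z < 1 \<Longrightarrow> Re (zf'_over_f f z) > 0"
    using assms(1) by (auto simp: class_starlike_def)
  have f'nz: "deriv f z \<noteq> 0" if "norm z < 1" for z
    using star [OF that] A by (cases "z = 0") (auto simp: zf'_over_f_def class_A_def)
  obtain q where q: "q holomorphic_on ball 0 1" "q 0 = 1"
    "\<And>z. norm z < 1 \<Longrightarrow> zf'_over_f f z = 1 / q z"
    "\<And>z. norm z < 1 \<Longrightarrow> q z \<noteq> 0 \<Longrightarrow> D f z = 1 + (1 + z * deriv q z) / q z"
    using D_eq_reciprocal_quotient [OF A f'nz] by metis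
  have qnz: "q z \<noteq> 0" if "norm z < 1" for z
    using star [OF that] q(3) [OF that] by auto
  have Req: "Re (q z) > 0" if "norm z < 1" for z
  proof -
    have "0 < Re (1 / q z)" using star [OF that] q(3) [OF that] by simp
    then show ?thesis
      using qnz [OF that] by (simp add: Re_complex_div_gt_0)
  qed
  have q1: "1 + q z \<noteq> 0" if "norm z < 1" for z
    using Req [OF that] by (auto simp: complex_eq_iff)
  define w where "w = (\<lambda>z. (1 - q z) / (1 + q z))"
  have holw: "w holomorphic_on ball 0 1"
    unfolding w_def by (intro holomorphic_intros q) (use q1 in auto)
  have w0: "w 0 = 0" by (simp add: w_def q)
  have wl: "norm (w z) < 1" if "norm z < 1" for z
  proof -
    have "(norm (1 - q z))\<^sup>2 < (norm (1 + q z))\<^sup>2"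
      using Req [OF that] unfolding cmod_power2
      by (simp add: power2_eq_square algebra_simps)
    then show ?thesis
      using q1 [OF that] by (simp add: w_def norm_divide power2_less_imp_less)
  qed
  define r t where "r = norm z" and "t = norm (w z)"
  have z1: "norm z < 1" using z by simp
  have tr: "0 \<le> t" "t \<le> r" "r < 1/2" "t < 1"
    using Schwarz_Lemma(1) [OF holw w0 wl z1] z wl [OF z1] by (auto simp: r_def t_def)
  have nz: "1 - w z \<noteq> 0" "1 + w z \<noteq> 0"
    using wl [OF z1] by (auto simp: add_eq_0_iff)
  have dq: "(q has_field_derivative deriv q z) (at z)"
    using holomorphic_derivI [OF q(1), of z] z1 by auto
  have "(w has_field_derivative (- deriv q z * (1 + q z) - (1 - q z) * deriv q z) / ((1 + q z) * (1 + q z))) (at z)"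
    unfolding w_def by (rule derivative_eq_intros dq refl | use q1 [OF z1] in simp)+
  then have dw: "deriv w z = - 2 * deriv q z / (1 + q z)\<^sup>2"
    by (simp add: DERIV_imp_deriv power2_eq_square algebra_simps)
  have ww: "1 - (w z)\<^sup>2 = 4 * q z / (1 + q z)\<^sup>2"
    using q1 [OF z1] by (simp add: w_def power_divide field_simps) (simp add: power2_eq_square algebra_simps)
  \<comment> \<open>Logarithmic derivative of \<open>q = (1 - w) / (1 + w)\<close>.\<close>
  have qq: "deriv q z / q z = - 2 * deriv w z / (1 - (w z)\<^sup>2)"
    unfolding dw ww using q1 [OF z1] qnz [OF z1] by (simp add: field_simps)
  have inv: "1 / q z = (1 + w z) / (1 - w z)"
  proof -
    have "1 - w z = q z * (1 + w z)"
      using q1 [OF z1] by (simp add: w_def field_simps)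
    then show ?thesis using nz(2) by simp
  qed
  have "Re ((1 + w z) / (1 - w z)) \<ge> (1 - r) / (1 + r)"
  proof -
    have "Re ((1 + w z) / (1 - w z)) = (1 - t\<^sup>2) / (norm (1 - w z))\<^sup>2"
      unfolding t_def cmod_power2 Re_divide by (simp add: power2_eq_square algebra_simps)
    also have "\<dots> \<ge> (1 - t\<^sup>2) / (1 + t)\<^sup>2"
    proof (intro divide_left_mono power_mono)
      show "norm (1 - w z) \<le> 1 + t"
        using norm_triangle_ineq4 [of 1 "w z"] by (simp add: t_def)
    qed (use tr nz in \<open>auto simp: power_le_one\<close>)
    also have "(1 - t\<^sup>2) / (1 + t)\<^sup>2 = ((1 - t) * (1 + t)) / ((1 + t) * (1 + t))"
      by (simp add: power2_eq_square algebra_simps)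
    also have "\<dots> = (1 - t) / (1 + t)"
      using tr by simp
    also have "(1 - t) / (1 + t) \<ge> (1 - r) / (1 + r)"
      using tr by (simp add: field_simps)
    finally show ?thesis .
  qed
  moreover have "norm (z * (deriv q z / q z)) \<le> 2 * r / (1 - r\<^sup>2)"
  proof -
    have t2: "1 - t\<^sup>2 > 0" "1 - r\<^sup>2 > 0" using tr by (auto simp: power_less_one_iff)
    \<comment> \<open>The numerator \<open>1 - t^2\<close> of Schwarz-Pick cancels against the lower
      bound for the modulus of \<open>1 - w^2\<close>, so the estimate depends on \<open>r\<close>
      alone.\<close>
    have "norm (deriv w z) \<le> (1 - t\<^sup>2) / (1 - r\<^sup>2)"
      using Schwarz_Pick [OF holw _ z1] wl less_imp_le unfolding t_def r_def by blast
    moreover have "norm (1 - (w z)\<^sup>2) \<ge> 1 - t\<^sup>2"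
      using norm_triangle_ineq2 [of 1 "(w z)\<^sup>2"] by (simp add: norm_power t_def)
    ultimately have "2 * r * norm (deriv w z) / norm (1 - (w z)\<^sup>2) \<le> 2 * r * ((1 - t\<^sup>2) / (1 - r\<^sup>2)) / (1 - t\<^sup>2)"
      using t2 tr by (intro frac_le mult_left_mono) auto
    moreover have "norm (z * (deriv q z / q z)) = 2 * r * norm (deriv w z) / norm (1 - (w z)\<^sup>2)"
      unfolding qq by (simp add: norm_mult norm_divide r_def)
    ultimately show ?thesis using t2 by simp
  qed
  then have "Re (z * (deriv q z / q z)) \<ge> - (2 * r / (1 - r\<^sup>2))"
    by (smt (verit) abs_Re_le_cmod)
  moreover have "D f z = 1 + (1 + w z) / (1 - w z) + z * (deriv q z / q z)"
    unfolding q(4) [OF z1 qnz [OF z1]] by (simp add: add_divide_distrib inv)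
  ultimately have "Re (D f z) \<ge> 1 + (1 - r) / (1 + r) - 2 * r / (1 - r\<^sup>2)"
    by simp
  also have "1 + (1 - r) / (1 + r) - 2 * r / (1 - r\<^sup>2) = 2 * (1 - 2 * r) / ((1 + r) * (1 - r))"
  proof -
    define d where "d = (1 + r) * (1 - r)"
    have "d \<noteq> 0" using tr by (simp add: d_def)
    moreover have "1 - r\<^sup>2 = d"
      by (simp add: d_def power2_eq_square algebra_simps)
    moreover have "(1 - r) / (1 + r) = (1 - r)\<^sup>2 / d"
      using tr by (simp add: d_def power2_eq_square)
    moreover have "1 + (1 - r)\<^sup>2 / d - 2 * r / d = (d + (1 - r)\<^sup>2 - 2 * r) / d"
      using \<open>d \<noteq> 0\<close> by (simp add: field_simps)
    moreover have "d + (1 - r)\<^sup>2 - 2 * r = 2 * (1 - 2 * r)"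
      by (simp add: d_def power2_eq_square algebra_simps)
    ultimately show ?thesis by (simp add: d_def)
  qed
  finally have "2 * (1 - 2 * r) / ((1 + r) * (1 - r)) \<le> Re (D f z)" .
  moreover have "2 * (1 - 2 * r) / ((1 + r) * (1 - r)) > 0" using tr by simp
  ultimately show ?thesis by linarith
qed

section \<open>The class G\<close>

text \<open>The line \<open>Re w = 3/4\<close> is the perpendicular bisector of the segment from
  \<open>1/2\<close> to 1.\<close>

lemma norm_diff_one_less_iff:
  "norm (w - 1) < norm (w - 1/2) \<longleftrightarrow> Re w > 3/4"
proof -
  have "norm (w - 1) < norm (w - 1/2) \<longleftrightarrow> (norm (w - 1))\<^sup>2 < (norm (w - 1/2))\<^sup>2"
    by (metis abs_norm_cancel abs_le_square_iff not_le)
  also have "\<dots> \<longleftrightarrow> Re w > 3/4"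
    unfolding cmod_power2 by (simp add: power2_eq_square algebra_simps) linarith
  finally show ?thesis .
qed

text \<open>
  The map \<open>w \<mapsto> (w - 1) / (w - 1/2)\<close> takes the half-plane \<open>Re w > 3/4\<close> into the unit disc and \<open>1\<close> to \<open>0\<close>.
\<close>

lemma halfplane_Schwarz:
  assumes holq: "q holomorphic_on ball 0 r" and q0: "q 0 = 1"
    and Re: "\<And>z. norm z < r \<Longrightarrow> Re (q z) > 3/4" and z: "norm z < r"
  shows "r * norm (q z - 1) \<le> norm z * norm (q z - 1/2)"
proof -
  have r: "r > 0" using z by (smt (verit) norm_ge_zero)
  define w where "w = (\<lambda>z. (q (of_real r * z) - 1) / (q (of_real r * z) - 1/2))"
  have inb: "norm (of_real r * z) < r" if "norm z < 1" for z :: complex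
    using that r by (simp add: norm_mult)
  have nz: "q z - 1/2 \<noteq> 0" if "norm z < r" for z
    using Re [OF that] by (auto simp: complex_eq_iff)
  have holqr: "(\<lambda>z. q (of_real r * z)) holomorphic_on ball 0 1"
    by (rule holomorphic_on_compose_gen [OF _ holq, unfolded o_def])
       (use inb in \<open>auto intro!: holomorphic_intros\<close>)
  have "w holomorphic_on ball 0 1"
    unfolding w_def by (intro holomorphic_intros holqr) (use inb nz in auto)
  moreover have "w 0 = 0" by (simp add: w_def q0)
  moreover have "norm (w z) < 1" if "norm z < 1" for z
    using norm_diff_one_less_iff [of "q (of_real r * z)"] Re inb [OF that] nz [OF inb [OF that]]
    by (simp add: w_def norm_divide)
  moreover have "norm (z / of_real r) < 1"
    using z r by (simp add: norm_divide)
  ultimately have "norm (w (z / of_real r)) \<le> norm (z / of_real r)"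
    by (rule Schwarz_Lemma(1))
  then have "norm (q z - 1) / norm (q z - 1/2) \<le> norm z / r"
    using r by (simp add: w_def norm_divide)
  moreover have "norm (q z - 1/2) > 0"
    using nz [OF z] by simp
  moreover have "r * x \<le> u * y" if "x / y \<le> u / r" "y > 0" for x y u
    using that r by (simp add: field_simps)
  ultimately show ?thesis by blast
qed

text \<open>
  Jack's lemma in half-plane form: the second claim is stationarity of \<open>Re q\<close> along the circle through
  \<open>z0\<close>, the third one compares derivatives at the end of the radius in \<open>halfplane_Schwarz\<close>.
\<close>

lemma halfplane_boundary_point:
  assumes holq: "q holomorphic_on ball 0 1" and q0: "q 0 = 1"
    and z0: "norm z0 < 1" and le: "Re (q z0) \<le> 3/4"
    and Re: "\<And>z. norm z < norm z0 \<Longrightarrow> Re (q z) > 3/4"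
  shows "Re (q z0) = 3/4" "Im (z0 * deriv q z0) = 0"
    "Re (z0 * deriv q z0) \<le> - 2 * ((norm (q z0 - 1/2))\<^sup>2)"
proof -
  define r0 where "r0 = norm z0"
  have z0nz: "z0 \<noteq> 0" using le q0 by auto
  then have r0: "0 < r0" "r0 < 1" using z0 by (auto simp: r0_def)
  have contq: "continuous_on (ball 0 1) q"
    using holq by (rule holomorphic_on_imp_continuous_on)
  have ge: "Re (q z) \<ge> 3/4" if "norm z \<le> r0" for z
  proof (rule continuous_ge_on_closure [of "ball 0 r0" "\<lambda>z. Re (q z)"])
    show "continuous_on (closure (ball 0 r0)) (\<lambda>z. Re (q z))"
      by (intro continuous_intros continuous_on_subset [OF contq]) (use r0 in auto)
  qed (use that r0 Re in \<open>auto simp: r0_def less_imp_le\<close>)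
  show eq: "Re (q z0) = 3/4"
    using ge [of z0] le by (simp add: r0_def)
  have dq: "(q has_field_derivative deriv q z0) (at z0)"
    using holomorphic_derivI [OF holq, of z0] z0 by auto
  define a b where "a = Re (z0 * deriv q z0)" and "b = Im (z0 * deriv q z0)"
  show "Im (z0 * deriv q z0) = 0"
  proof -
    \<comment> \<open>Along the rotation of \<open>z0\<close> by the angle \<open>t\<close>,
      \<open>Re q\<close> is minimal at \<open>t = 0\<close>, and its derivative there is
      \<open>- Im (z0 * deriv q z0)\<close>.\<close>
    have "((\<lambda>w. q (exp (\<i> * w) * z0)) has_field_derivative deriv q z0 * (\<i> * z0)) (at (of_real 0))"
      by (rule DERIV_chain2 [where f = q]) (use dq in \<open>auto intro!: derivative_eq_intros\<close>)
    then have "((\<lambda>t::real. q (exp (\<i> * of_real t) * z0)) has_vector_derivative deriv q z0 * (\<i> * z0)) (at 0)"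
      by (rule has_vector_derivative_real_field [where f = "\<lambda>w. q (exp (\<i> * w) * z0)"])
    then have d: "((\<lambda>t::real. Re (q (exp (\<i> * of_real t) * z0))) has_real_derivative Re (deriv q z0 * (\<i> * z0))) (at 0)"
      by (auto simp: has_vector_derivative_complex_iff)
    have "Re (q z0) \<le> Re (q (exp (\<i> * of_real t) * z0))" for t :: real
      unfolding eq by (rule ge) (simp add: r0_def norm_mult)
    then have "Re (deriv q z0 * (\<i> * z0)) = 0"
      by (intro DERIV_local_min [OF d zero_less_one]) auto
    then show ?thesis by (simp add: algebra_simps)
  qed
  define u v where "u = (\<lambda>t::real. Re (q (of_real t * z0)))" and "v = (\<lambda>t::real. Im (q (of_real t * z0)))"
  have "((\<lambda>w. q (w * z0)) has_field_derivative deriv q z0 * z0) (at (of_real 1))"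
    by (rule DERIV_chain2 [where f = q]) (use dq in \<open>auto intro!: derivative_eq_intros\<close>)
  then have "((\<lambda>t::real. q (of_real t * z0)) has_vector_derivative deriv q z0 * z0) (at 1)"
    by (rule has_vector_derivative_real_field [where f = "\<lambda>w. q (w * z0)"])
  then have du: "(u has_real_derivative a) (at 1)" and dv: "(v has_real_derivative b) (at 1)"
    by (auto simp: has_vector_derivative_complex_iff u_def v_def a_def b_def mult.commute)
  \<comment> \<open>\<open>g t \<ge> 0\<close> is \<open>halfplane_Schwarz\<close> at
    \<open>t * z0\<close>, squared. As \<open>g 1 = 0\<close> on the bisector, the derivative
    \<open>d\<close> of \<open>g\<close> at 1 cannot be positive; the contributions of
    \<open>b\<close> cancel in \<open>d\<close>.\<close>
  define g where "g = (\<lambda>t. t\<^sup>2 * ((u t - 1/2)\<^sup>2 + (v t)\<^sup>2) - ((u t - 1)\<^sup>2 + (v t)\<^sup>2))"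
  define d where "d = 2 * ((u 1 - 1/2)\<^sup>2 + (v 1)\<^sup>2) + a"
  have dg: "(g has_real_derivative d) (at 1)"
    unfolding g_def d_def by (rule derivative_eq_intros du dv refl)+ (simp add: algebra_simps)
  have u1: "u 1 = 3/4" using eq by (simp add: u_def)
  have g1: "g 1 = 0" by (simp add: g_def u1 power2_eq_square)
  have g0: "g t \<ge> 0" if t: "0 < t" "t < 1" for t
  proof -
    have "r0 * norm (q (of_real t * z0) - 1) \<le> norm (of_real t * z0) * norm (q (of_real t * z0) - 1/2)"
    proof (rule halfplane_Schwarz [where q = q])
      show "q holomorphic_on ball 0 r0"
        by (rule holomorphic_on_subset [OF holq]) (use r0 in auto)
    qed (use q0 Re t z0nz in \<open>auto simp: r0_def norm_mult\<close>)
    then have "norm (q (of_real t * z0) - 1) \<le> t * norm (q (of_real t * z0) - 1/2)"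
      using t z0nz by (simp add: r0_def norm_mult mult.assoc mult.left_commute)
    then have "(norm (q (of_real t * z0) - 1))\<^sup>2 \<le> (t * norm (q (of_real t * z0) - 1/2))\<^sup>2"
      by (intro power_mono) auto
    then show ?thesis
      unfolding power_mult_distrib cmod_power2 by (simp add: g_def u_def v_def)
  qed
  have "d \<le> 0"
  proof (rule ccontr)
    assume "\<not> d \<le> 0"
    then obtain e where e: "e > 0" "\<And>h. h > 0 \<Longrightarrow> h < e \<Longrightarrow> g (1 - h) < g 1"
      using DERIV_pos_inc_left [OF dg] by force
    define h where "h = min (e / 2) (1 / 2)"
    have "h > 0" "h < e" "h < 1" using e(1) by (auto simp: h_def)
    then show False
      using e(2) [of h] g0 [of "1 - h"] g1 by simp
  qed
  then show "Re (z0 * deriv q z0) \<le> - 2 * ((norm (q z0 - 1/2))\<^sup>2)"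
    unfolding cmod_power2 by (simp add: d_def a_def u_def v_def)
qed

text \<open>At a point of least modulus with \<open>Re q \<le> 3/4\<close>,
  \<open>halfplane_boundary_point\<close> makes \<open>z q'\<close> a real number \<open>a\<close>
  so negative that the real part of \<open>1 + z f'' / f' = (1 - a) / q\<close> reaches
  \<open>3/2\<close>, contradicting the hypothesis. The half-plane bound then confines
  \<open>q z\<close> to a disc on which \<open>Re (1 / q) \<ge> 1/2\<close>.\<close>

lemma class_G_Re_D_pos:
  assumes "f \<in> class_G" and z: "norm z < 2/3"
  shows "Re (D f z) > 0"
proof -
  have A: "f \<in> class_A" and f'nz: "\<And>z. norm z < 1 \<Longrightarrow> deriv f z \<noteq> 0"
    and G: "\<And>z. norm z < 1 \<Longrightarrow> Re (1 + z * deriv (deriv f) z / deriv f z) < 3/2"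
    using assms(1) by (auto simp: class_G_def)
  obtain q where q: "q holomorphic_on ball 0 1" "q 0 = 1"
    "\<And>z. norm z < 1 \<Longrightarrow> zf'_over_f f z = 1 / q z"
    "\<And>z. norm z < 1 \<Longrightarrow> q z * (1 + z * deriv (deriv f) z / deriv f z) = 1 - z * deriv q z"
    using D_eq_reciprocal_quotient [OF A f'nz] by metis
  have Re: "Re (q z) > 3/4" if z: "norm z < 1" for z
  proof (rule ccontr)
    assume "\<not> Re (q z) > 3/4"
    define S where "S = {w \<in> cball 0 (norm z). Re (q w) \<le> 3/4}"
    have "continuous_on (cball 0 (norm z)) (\<lambda>z. Re (q z))"
      by (intro continuous_intros continuous_on_subset [OF holomorphic_on_imp_continuous_on [OF q(1)]])
         (use z in auto)
    then have "closed S"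
      unfolding S_def by (rule continuous_on_closed_Collect_le [OF _ continuous_on_const closed_cball])
    moreover have "bounded S"
      by (rule bounded_subset [of "cball 0 (norm z)"]) (auto simp: S_def)
    ultimately have "compact S"
      by (simp add: compact_eq_bounded_closed)
    moreover have "S \<noteq> {}"
      using \<open>\<not> Re (q z) > 3/4\<close> by (auto simp: S_def intro!: exI [of _ z])
    ultimately obtain z0 where z0: "z0 \<in> S" "\<And>w. w \<in> S \<Longrightarrow> norm z0 \<le> norm w"
      using continuous_attains_inf [of S norm] by (auto intro: continuous_intros)
    have z01: "norm z0 < 1" and le: "Re (q z0) \<le> 3/4"
      using z0(1) z by (auto simp: S_def)
    have less: "Re (q w) > 3/4" if "norm w < norm z0" for w
    proof (rule ccontr)
      assume "\<not> Re (q w) > 3/4"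
      then have "w \<in> S"
        using that z0(1) by (auto simp: S_def)
      with z0(2) that show False by force
    qed
    define y a where "y = Im (q z0)" and "a = Re (z0 * deriv q z0)"
    note bp = halfplane_boundary_point [OF q(1,2) z01 le less]
    have qz0: "q z0 = Complex (3/4) y"
      using bp(1) by (simp add: y_def complex_eq_iff)
    have a: "a \<le> - 2 * (1/16 + y\<^sup>2)"
      using bp(3) unfolding cmod_power2 by (simp add: a_def y_def bp(1) power2_eq_square)
    have "z0 * deriv q z0 = of_real a"
      using bp(2) by (simp add: a_def complex_eq_iff)
    then have "q z0 * (1 + z0 * deriv (deriv f) z0 / deriv f z0) = of_real (1 - a)"
      using q(4) [OF z01] by simp
    moreover have "q z0 \<noteq> 0" by (simp add: qz0 complex_eq_iff)
    ultimately have "1 + z0 * deriv (deriv f) z0 / deriv f z0 = of_real (1 - a) / q z0"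
      by (simp add: field_simps)
    then have "Re (1 + z0 * deriv (deriv f) z0 / deriv f z0) = (1 - a) * (3/4) / (9/16 + y\<^sup>2)"
      by (simp add: qz0 Re_divide power2_eq_square)
    moreover have "0 < 9/16 + y\<^sup>2"
      by (simp add: add_pos_nonneg)
    \<comment> \<open>For the extreme value \<open>a = - 2 * (1/16 + y^2)\<close> both sides agree,
      which is how the line \<open>3/4\<close> matches the constant \<open>3/2\<close>.\<close>
    moreover have "3/2 * (9/16 + y\<^sup>2) \<le> (1 - a) * (3/4)"
      using a by simp
    ultimately show False
      using G [OF z01] by (simp add: pos_divide_less_eq)
  qed
  define X Y where "X = Re (q z)" and "Y = Im (q z)"
  have z1: "norm z < 1" using z by simp
  have "norm (q z - 1) \<le> norm z * norm (q z - 1/2)"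
    using halfplane_Schwarz [OF q(1,2) Re z1] by simp
  also have "\<dots> \<le> 2/3 * norm (q z - 1/2)"
    using z by (intro mult_right_mono) auto
  finally have "(norm (q z - 1))\<^sup>2 \<le> (2/3 * norm (q z - 1/2))\<^sup>2"
    by (intro power_mono) auto
  \<comment> \<open>An Apollonius disc with centre \<open>7/5\<close> and radius \<open>3/5\<close>,
    hence \<open>4/5 \<le> X \<le> 2\<close>. For \<open>X \<le> 2\<close> the right side is at most
    \<open>10 * X\<close>, which says \<open>Re (1 / q z) \<ge> 1/2\<close>.\<close>
  then have XY: "5 * (X\<^sup>2 + Y\<^sup>2) \<le> 14 * X - 8"
    unfolding power_mult_distrib cmod_power2 X_def Y_def by (simp add: power2_eq_square field_simps)
  have "(5 * X - 4) * (X - 2) \<le> 0"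
  proof -
    have "5 * X\<^sup>2 + 8 \<le> 14 * X"
      using XY zero_le_power2 [of Y] unfolding distrib_left by linarith
    then show ?thesis by (simp add: power2_eq_square algebra_simps)
  qed
  moreover have "X > 3/4" using Re [OF z1] by (simp add: X_def)
  ultimately have "X \<le> 2"
    by (smt (verit) mult_pos_pos)
  with XY have "X\<^sup>2 + Y\<^sup>2 \<le> 2 * X" by simp
  moreover have "X\<^sup>2 + Y\<^sup>2 > 0"
    using \<open>X > 3/4\<close> by (simp add: add_pos_nonneg)
  ultimately have "Re (1 / q z) \<ge> 1/2"
    by (simp add: Re_divide X_def Y_def field_simps)
  moreover have "Re (z * deriv (deriv f) z / deriv f z) < 1/2"
    using G [OF z1] by simp
  moreover have "Re (D f z) = 2 * Re (1 / q z) - Re (z * deriv (deriv f) z / deriv f z)"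
    unfolding D_def q(3) [OF z1] mult_2 minus_complex.sel plus_complex.sel by (rule refl)
  ultimately show ?thesis by linarith
qed

section \<open>Univalent functions\<close>

text \<open>Cauchy's inequality on circles of radius \<open>r < 1\<close>, in the limit
  \<open>r\<close> to 1, bounds every Taylor coefficient by \<open>B\<close>; the tail from degree 2
  on is dominated by a geometric series.\<close>

lemma Taylor_remainder_bound:
  assumes holf: "f holomorphic_on ball 0 1" and B: "\<And>z. norm z < 1 \<Longrightarrow> norm (f z) \<le> B"
    and w: "norm w < 1"
  shows "norm (f w - f 0 - deriv f 0 * w) \<le> B * (norm w)\<^sup>2 / (1 - norm w)"
proof -
  define a where "a = (\<lambda>n. (deriv ^^ n) f 0 / fact n)"
  have a: "norm (a n) \<le> B" for n
  proof -
    have *: "norm (a n) * r ^ n \<le> B" if r: "0 < r" "r < 1" for r :: real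
    proof -
      have "norm ((deriv ^^ n) f 0) \<le> fact n * B / r ^ n"
      proof (rule Cauchy_inequality)
        show "f holomorphic_on ball 0 r"
          by (rule holomorphic_on_subset [OF holf]) (use r in auto)
        show "continuous_on (cball 0 r) f"
          by (rule continuous_on_subset [OF holomorphic_on_imp_continuous_on [OF holf]]) (use r in auto)
      qed (use r B in auto)
      then show ?thesis
        using r by (simp add: a_def norm_divide field_simps)
    qed
    have "\<forall>\<^sub>F r in at_left (1::real). r \<in> {0<..<1}"
      by (rule eventually_at_left_real) simp
    then have "\<forall>\<^sub>F r in at_left (1::real). norm (a n) * r ^ n \<le> B"
      by eventually_elim (rule *, auto)
    moreover have "((\<lambda>r::real. norm (a n) * r ^ n) \<longlongrightarrow> norm (a n) * 1 ^ n) (at_left 1)"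
      by (intro tendsto_intros)
    ultimately have "norm (a n) * 1 ^ n \<le> B"
      by (intro tendsto_upperbound [of "\<lambda>r::real. norm (a n) * r ^ n" _ "at_left 1"]) simp_all
    then show ?thesis by simp
  qed
  have "(\<lambda>n. a n * w ^ n) sums f w"
    using holomorphic_power_series [OF holf, of w] w by (simp add: a_def)
  then have "(\<lambda>n. a (n + 2) * w ^ (n + 2)) sums (f w - (\<Sum>n<2. a n * w ^ n))"
    by (rule sums_split_initial_segment)
  moreover have "f w - (\<Sum>n<2. a n * w ^ n) = f w - f 0 - deriv f 0 * w"
    by (simp add: numeral_2_eq_2 a_def)
  ultimately have s: "(\<lambda>n. a (n + 2) * w ^ (n + 2)) sums (f w - f 0 - deriv f 0 * w)"
    by (simp only:)
  have g: "(\<lambda>n. B * (norm w)\<^sup>2 * norm w ^ n) sums (B * (norm w)\<^sup>2 * (1 / (1 - norm w)))"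
    by (intro sums_mult geometric_sums) (use w in auto)
  have le: "norm (a (n + 2) * w ^ (n + 2)) \<le> B * (norm w)\<^sup>2 * norm w ^ n" for n
  proof -
    have "norm (a (n + 2) * w ^ (n + 2)) = norm (a (n + 2)) * (norm w)\<^sup>2 * norm w ^ n"
      by (simp only: norm_mult norm_power power_add mult_ac)
    also have "\<dots> \<le> B * (norm w)\<^sup>2 * norm w ^ n"
      by (intro mult_right_mono a) auto
    finally show ?thesis .
  qed
  have "norm (\<Sum>n. a (n + 2) * w ^ (n + 2)) \<le> (\<Sum>n. B * (norm w)\<^sup>2 * norm w ^ n)"
    by (rule norm_suminf_le [OF le sums_summable [OF g]])
  then show ?thesis
    unfolding sums_unique [OF s, symmetric] sums_unique [OF g, symmetric] by simp
qed

section \<open>A weak form of Koebe's one-quarter theorem\<close>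

text \<open>
  The right loop of the lemniscate \<open>|u\<^sup>2 - 1| < 1\<close> is the image of \<open>|x| < 1\<close> under the principal branch
  of \<open>sqrt (1 - x)\<close>. Centre and radius of the inscribed disc are nearly optimal (the best disc has
  centre \<open>sqrt 3 / 2\<close> and radius \<open>1/2\<close>), with \<open>(1 + 7/8) / (15/32) = 4\<close>.
\<close>

lemma cball_subset_lemniscate_loop:
  fixes u :: complex
  assumes "norm (u - 7/8) \<le> 15/32"
  shows "Re u > 0" "norm (u\<^sup>2 - 1) < 1"
proof -
  define x y where "x = Re u" and "y = Im u"
  have "\<bar>x - 7/8\<bar> \<le> 15/32"
    using abs_Re_le_cmod [of "u - 7/8"] assms by (simp add: x_def)
  then have x: "x \<ge> 13/32" by linarith
  then show "Re u > 0" by (simp add: x_def)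
  have "(norm (u - 7/8))\<^sup>2 \<le> (15/32)\<^sup>2"
    using assms by (intro power_mono) auto
  then have "x\<^sup>2 + y\<^sup>2 + 1 \<le> 465/1024 + 7/4 * x"
    unfolding cmod_power2 x_def y_def by (simp add: power2_eq_square algebra_simps)
  then have "(x\<^sup>2 + y\<^sup>2 + 1)\<^sup>2 \<le> (465/1024 + 7/4 * x)\<^sup>2"
    by (intro power_mono) auto
  moreover have "(norm (u\<^sup>2 - 1))\<^sup>2 = (x\<^sup>2 + y\<^sup>2 + 1)\<^sup>2 - 4 * x\<^sup>2"
    unfolding cmod_power2 x_def y_def by (simp add: power2_eq_square algebra_simps)
  \<comment> \<open>Completing the square: the concave quadratic in \<open>x\<close> has its vertex
    at \<open>217/256\<close> and a maximum below 1.\<close>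
  moreover have "(465/1024 + 7/4 * x)\<^sup>2 - 4 * x\<^sup>2 = 1 - 15/16 * (x - 217/256)\<^sup>2 - (1 - 465^2/1024^2 - 15/16 * (217/256)\<^sup>2)"
    by (simp add: power2_eq_square algebra_simps)
  moreover have "15/16 * (x - 217/256)\<^sup>2 \<ge> 0"
    by simp
  ultimately have "(norm (u\<^sup>2 - 1))\<^sup>2 \<le> 1 - (1 - 465^2/1024^2 - 15/16 * (217/256)\<^sup>2)"
    by linarith
  also have "\<dots> < 1"
    by (simp add: power2_eq_square)
  finally have "(norm (u\<^sup>2 - 1))\<^sup>2 < 1" .
  then show "norm (u\<^sup>2 - 1) < 1"
    by (simp add: abs_square_less_1)
qed

text \<open>A disc about 0 that is not covered would, being connected, meet the frontier of the open
  image. Frontier points are values of \<open>f\<close> on the circle of radius \<open>R\<close>,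
  hence have modulus at least \<open>d\<close>.\<close>

lemma ball_subset_image_of_univalent:
  fixes f :: "complex \<Rightarrow> complex"
  assumes holf: "f holomorphic_on ball 0 1" and inj: "inj_on f (ball 0 1)" and R: "0 < R" "R < 1"
    and f0: "f 0 = 0" and d: "\<And>z. norm z = R \<Longrightarrow> d \<le> norm (f z)"
  shows "ball 0 d \<subseteq> f ` ball 0 R"
proof (rule ccontr)
  assume "\<not> ball 0 d \<subseteq> f ` ball 0 R"
  then have ne: "ball 0 d - f ` ball 0 R \<noteq> {}" by blast
  then have "d > 0" by (metis Diff_empty ball_empty empty_Diff not_le)
  moreover have "0 \<in> f ` ball 0 R" using f0 R by force
  ultimately have "ball 0 d \<inter> frontier (f ` ball 0 R) \<noteq> {}"
    using connected_Int_frontier [OF connected_ball _ ne] by (metis IntI centre_in_ball emptyE)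
  then obtain y where y: "norm y < d" "y \<in> frontier (f ` ball 0 R)" by auto
  have op: "open (f ` ball 0 R)"
    by (rule open_mapping_thm3 [OF holomorphic_on_subset [OF holf] _ inj_on_subset [OF inj]]) (use R in auto)
  have "compact (f ` cball 0 R)"
    by (intro compact_continuous_image continuous_on_subset [OF holomorphic_on_imp_continuous_on [OF holf]])
       (use R in auto)
  then have "closure (f ` ball 0 R) \<subseteq> f ` cball 0 R"
    by (intro closure_minimal compact_imp_closed) (auto simp: image_mono)
  then obtain x where x: "norm x \<le> R" "y = f x" "y \<notin> f ` ball 0 R"
    using y(2) op by (force simp: frontier_def interior_open)
  then have "norm x = R" by force
  with d [of x] x y show False by simp
qed

text \<open>
  Let \<open>v\<close> be a value of least modulus on the sphere. The branch \<open>h\<close> of \<open>sqrt (1 - f / v)\<close> with \<open>h 0 = 1\<close>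
  covers the right loop of the lemniscate, and its image is disjoint from its negative by injectivity,
  so \<open>h\<close> omits a disc around \<open>-7/8\<close>. Hence \<open>log ((h + 7/8) / (15/32))\<close> has positive real part, which
  bounds its derivative at \<open>0\<close>, and thereby \<open>1 / |v|\<close>.
\<close>

lemma weak_Koebe_sphere:
  assumes holf: "f holomorphic_on ball 0 1" and inj: "inj_on f (ball 0 1)"
    and f0: "f 0 = 0" and f'0: "deriv f 0 = 1" and R: "0 < R" "R < 1" and w: "norm w = R"
  shows "R \<le> 21/2 * norm (f w)"
proof -
  have contf: "continuous_on (ball 0 1) f"
    using holf by (rule holomorphic_on_imp_continuous_on)
  have "\<exists>x\<in>sphere 0 R. \<forall>y\<in>sphere 0 R. norm (f x) \<le> norm (f y)"
  proof (rule continuous_attains_inf)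
    show "sphere (0::complex) R \<noteq> {}" using R by simp
    show "continuous_on (sphere 0 R) (\<lambda>z. norm (f z))"
      by (intro continuous_on_norm continuous_on_subset [OF contf]) (use R in auto)
  qed auto
  then obtain x where x: "norm x = R" "\<And>y. norm y = R \<Longrightarrow> norm (f x) \<le> norm (f y)"
    by auto
  define v where "v = f x"
  have "x \<noteq> 0" using x R by auto
  then have v0: "v \<noteq> 0"
    using inj_onD [OF inj, of x 0] x(1) R f0 by (auto simp: v_def)
  have cover: "ball 0 (norm v) \<subseteq> f ` ball 0 R"
    by (rule ball_subset_image_of_univalent [OF holf inj R f0]) (use x in \<open>auto simp: v_def\<close>)
  have sub: "ball 0 R \<subseteq> ball (0::complex) 1" using R by auto
  have fv: "f z \<noteq> v" if "norm z < R" for z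
  proof
    assume "f z = v"
    have "x = z"
      by (rule inj_onD [OF inj]) (use x(1) R that \<open>f z = v\<close> in \<open>simp_all add: v_def\<close>)
    with x(1) that show False by simp
  qed
  have holfR: "f holomorphic_on ball 0 R"
    using holf sub by (rule holomorphic_on_subset)
  have "(\<lambda>z. 1 - f z / v) holomorphic_on ball 0 R"
    by (intro holomorphic_intros holfR) (use v0 in auto)
  moreover have "1 - f z / v \<noteq> 0" if "z \<in> ball 0 R" for z
    using fv [of z] v0 that by auto
  ultimately obtain l where l: "l holomorphic_on ball 0 R" "\<And>z. z \<in> ball 0 R \<Longrightarrow> exp (l z) = 1 - f z / v"
    using holomorphic_logarithm_exists [of "ball 0 R" "\<lambda>z. 1 - f z / v" 0] R by auto
  \<comment> \<open>Subtracting \<open>l 0\<close>, possibly a nonzero multiple of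
    \<open>2 * pi * \<i>\<close>, selects the branch with \<open>h 0 = 1\<close>.\<close>
  define h where "h = (\<lambda>z. exp ((l z - l 0) / 2))"
  have l0: "exp (l 0) = 1" using l(2) [of 0] R f0 by simp
  have holh: "h holomorphic_on ball 0 R"
    unfolding h_def by (intro holomorphic_intros l) auto
  have h0: "h 0 = 1" and hnz: "\<And>z. h z \<noteq> 0" by (auto simp: h_def)
  have h2: "(h z)\<^sup>2 = 1 - f z / v" if "norm z < R" for z
  proof -
    have "(h z)\<^sup>2 = exp (2 * ((l z - l 0) / 2))"
      by (simp only: h_def exp_double)
    also have "2 * ((l z - l 0) / 2) = l z - l 0"
      by simp
    finally have "(h z)\<^sup>2 = exp (l z - l 0)" .
    then show ?thesis
      using l(2) [of z] that l0 by (simp add: exp_diff)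
  qed
  have hneg: "h z \<noteq> - h z'" if z: "norm z < R" "norm z' < R" for z z'
  proof
    assume eq: "h z = - h z'"
    then have "1 - f z / v = 1 - f z' / v"
      using h2 z by (metis power2_minus)
    then have "f z = f z'" using v0 by simp
    then have "z = z'" using inj_onD [OF inj] z R by auto
    with eq hnz show False by simp
  qed
  have omit: "norm (h z + 7/8) > 15/32" if z: "norm z < R" for z
  proof (rule ccontr)
    define u where "u = - h z"
    assume "\<not> norm (h z + 7/8) > 15/32"
    then have "norm (u - 7/8) \<le> 15/32"
      unfolding u_def using norm_minus_cancel [of "h z + 7/8"] by simp
    note u = cball_subset_lemniscate_loop [OF this]
    \<comment> \<open>\<open>V\<close> is the preimage of the covered disc, connected as the image
      of that disc under the inverse of \<open>f\<close>. On \<open>V\<close> the square of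
      \<open>h\<close> stays within distance 1 of 1, so \<open>Re h\<close> has no zero and keeps
      the sign it has at 0. This excludes \<open>h z' = - u\<close>.\<close>
    define V where "V = {z \<in> ball 0 R. norm (f z) < norm v}"
    have "norm (v * (1 - u\<^sup>2)) < norm v"
      using u(2) v0 by (simp add: norm_mult norm_minus_commute)
    then have "v * (1 - u\<^sup>2) \<in> f ` ball 0 R" using cover by auto
    then obtain z' where z': "norm z' < R" "f z' = v * (1 - u\<^sup>2)" by auto
    then have z'V: "z' \<in> V"
      using \<open>norm (v * (1 - u\<^sup>2)) < norm v\<close> by (simp add: V_def)
    obtain g where g: "g holomorphic_on f ` ball 0 1" "\<And>z. z \<in> ball 0 1 \<Longrightarrow> g (f z) = z"
      using holomorphic_has_inverse [OF holf open_ball inj] by metis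
    have "V = g ` ball 0 (norm v)"
    proof
      show "V \<subseteq> g ` ball 0 (norm v)"
        using g(2) sub by (force simp: V_def)
      show "g ` ball 0 (norm v) \<subseteq> V"
        using cover g(2) sub by (force simp: V_def)
    qed
    moreover have "connected (g ` ball 0 (norm v))"
      by (intro connected_continuous_image holomorphic_on_imp_continuous_on holomorphic_on_subset [OF g(1)])
         (use cover sub in auto)
    ultimately have "connected V" by simp
    moreover have "continuous_on V (\<lambda>z. Re (h z))"
      by (intro continuous_intros continuous_on_subset [OF holomorphic_on_imp_continuous_on [OF holh]])
         (auto simp: V_def)
    ultimately have conn: "connected ((\<lambda>z. Re (h z)) ` V)"
      by (rule connected_continuous_image [rotated])
    have Renz: "Re (h z) \<noteq> 0" if "z \<in> V" for z
    proof
      assume 0: "Re (h z) = 0"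
      have "norm (1 - (h z)\<^sup>2) < 1"
        using that v0 h2 [of z] by (simp add: V_def norm_divide)
      moreover have "1 \<le> Re (1 - (h z)\<^sup>2)"
        using 0 by (simp add: power2_eq_square)
      ultimately show False
        using complex_Re_le_cmod [of "1 - (h z)\<^sup>2"] by linarith
    qed
    have "0 \<in> V" using R v0 by (simp add: V_def f0)
    then have one: "1 \<in> (\<lambda>z. Re (h z)) ` V" using h0 by force
    have "Re (h z') > 0"
    proof (rule ccontr)
      assume "\<not> Re (h z') > 0"
      then have "0 \<in> (\<lambda>z. Re (h z)) ` V"
        using connectedD_interval [OF conn imageI [OF z'V] one, of 0] by simp
      then show False using Renz by force
    qed
    moreover have "(h z')\<^sup>2 = u\<^sup>2"
      using h2 [OF z'(1)] z'(2) v0 by simp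
    then have "h z' = u \<or> h z' = - u"
      by (simp add: power2_eq_iff)
    ultimately have "h z' = u" using u(1) by auto
    then show False using hneg [OF z'(1) z] by (simp add: u_def)
  qed
  \<comment> \<open>Rescaling to the unit disc makes the omitted disc the closed unit disc, with
    \<open>m 0 = (1 + 7/8) / (15/32) = 4\<close>.\<close>
  define m where "m = (\<lambda>z. (h (of_real R * z) + 7/8) / (15/32))"
  have inR: "norm (of_real R * z) < R" if "norm z < 1" for z :: complex
    using that R by (simp add: norm_mult)
  have holm: "m holomorphic_on ball 0 1"
    unfolding m_def
    by (intro holomorphic_intros holomorphic_on_compose_gen [OF _ holh, unfolded o_def])
       (use inR in auto)
  have m1: "norm (m z) > 1" if "norm z < 1" for z
    using omit [OF inR [OF that]] unfolding m_def norm_divide by simp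
  then have "m z \<noteq> 0" if "z \<in> ball 0 1" for z
    using that by fastforce
  then obtain L where L: "L holomorphic_on ball 0 1" "\<And>z. z \<in> ball 0 1 \<Longrightarrow> exp (L z) = m z"
    using holomorphic_logarithm_exists [of "ball 0 1" m 0] holm by auto
  have ReL: "Re (L z) = ln (norm (m z))" if "norm z < 1" for z
    using L(2) [of z] that by (metis ln_exp mem_ball_0 norm_exp_eq_Re)
  have "Re (L z) > 0" if "norm z < 1" for z
    using ReL [OF that] ln_gt_zero [OF m1 [OF that]] by simp
  then have "norm (deriv L 0) \<le> 2 * Re (L 0)"
    by (rule halfplane_deriv_bound [OF L(1)])
  also have "Re (L 0) = ln 4"
    using ReL [of 0] by (simp add: m_def h0)
  also have "ln 4 = 2 * ln (2::real)"
    using ln_realpow [of 2 2] by simp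
  also have "2 * (2 * ln (2::real)) \<le> 2 * (2 * (25/36))"
    using ln2_le_25_over_36 by simp
  finally have L': "norm (deriv L 0) \<le> 25/9" by simp
  have dh: "(h has_field_derivative deriv h 0) (at 0)"
    using holomorphic_derivI [OF holh, of 0] R by auto
  have "deriv h 0 = - 1 / (2 * v)"
  proof -
    have "((\<lambda>z. (h z)\<^sup>2) has_field_derivative 2 * deriv h 0) (at 0)"
      using dh by (auto intro!: derivative_eq_intros simp: h0)
    moreover have "((\<lambda>z. 1 - f z / v) has_field_derivative - 1 / v) (at 0)"
      using holomorphic_derivI [OF holf, of 0] f'0 v0 by (auto intro!: derivative_eq_intros)
    then have "((\<lambda>z. (h z)\<^sup>2) has_field_derivative - 1 / v) (at 0)"
      by (rule has_field_derivative_transform_within_open [where S = "ball 0 R"]) (use h2 R in auto)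
    ultimately have "2 * deriv h 0 = - 1 / v" by (rule DERIV_unique)
    then show ?thesis using v0 by (simp add: field_simps)
  qed
  have "deriv L 0 = R * deriv h 0 * (8/15)"
  proof -
    have "((\<lambda>z. h (of_real R * z)) has_field_derivative deriv h 0 * R) (at 0)"
      by (rule DERIV_chain2 [where f = h]) (use dh in \<open>auto intro!: derivative_eq_intros\<close>)
    then have "(m has_field_derivative (deriv h 0 * R) / (15/32)) (at 0)"
      unfolding m_def by (auto intro!: derivative_eq_intros)
    moreover have "((\<lambda>z. exp (L z)) has_field_derivative exp (L 0) * deriv L 0) (at 0)"
      using holomorphic_derivI [OF L(1), of 0] by (auto intro!: derivative_eq_intros)
    then have "(m has_field_derivative exp (L 0) * deriv L 0) (at 0)"
      by (rule has_field_derivative_transform_within_open [where S = "ball 0 1"]) (use L(2) in auto)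
    ultimately have "(deriv h 0 * R) / (15/32) = exp (L 0) * deriv L 0" by (rule DERIV_unique)
    moreover have "exp (L 0) = 4"
      using L(2) [of 0] by (simp add: m_def h0)
    ultimately show ?thesis by (simp add: field_simps)
  qed
  then have "norm (deriv L 0) = 4/15 * R / norm v"
    using \<open>deriv h 0 = - 1 / (2 * v)\<close> R by (simp add: norm_mult norm_divide)
  \<comment> \<open>This gives \<open>R \<le> 125/12 * norm v\<close>, and
    \<open>125/12 < 21/2\<close>.\<close>
  with L' have "4/15 * R \<le> 25/9 * norm v"
    using v0 by (simp add: divide_le_eq)
  then have "R \<le> 21/2 * norm v" using norm_ge_zero [of v] by linarith
  also have "\<dots> \<le> 21/2 * norm (f w)" using x(2) [OF w] by (simp add: v_def)
  finally show ?thesis .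
qed

text \<open>\<open>g\<close> is \<open>z / f\<close>, characterized by a product so as to cover the
  origin. \<open>weak_Koebe_sphere\<close> bounds it on every circle about 0, and the maximum
  modulus principle carries the bound inside.\<close>

lemma class_S_reciprocal_bounded:
  assumes "f \<in> class_S"
  obtains g where "g holomorphic_on ball 0 1" "g 0 = 1" "deriv g 0 = - deriv (deriv f) 0 / 2"
    "\<And>z. norm z < 1 \<Longrightarrow> f z * g z = z" "\<And>z. norm z < 1 \<Longrightarrow> norm (g z) \<le> 21/2"
proof -
  have A: "f \<in> class_A" and inj: "inj_on f (ball 0 1)"
    using assms by (auto simp: class_S_def)
  have holf: "f holomorphic_on ball 0 1" and f0: "f 0 = 0" and f'0: "deriv f 0 = 1"
    using A by (auto simp: class_A_def)
  obtain k where k: "k holomorphic_on ball 0 1" "k 0 = 1" "\<And>z. norm z < 1 \<Longrightarrow> f z = z * k z"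
    "deriv (deriv f) 0 = 2 * deriv k 0"
    using class_A_factor [OF A] by metis
  have knz: "k z \<noteq> 0" if "norm z < 1" for z
  proof
    assume "k z = 0"
    then have "f z = f 0" using k(3) [OF that] f0 by simp
    then have "z = 0" by (rule inj_onD [OF inj]) (use that in auto)
    with \<open>k z = 0\<close> k(2) show False by simp
  qed
  define g where "g = (\<lambda>z. 1 / k z)"
  have holg: "g holomorphic_on ball 0 1"
    unfolding g_def by (intro holomorphic_intros k(1)) (use knz in auto)
  have "(g has_field_derivative - deriv k 0) (at 0)"
    using holomorphic_derivI [OF k(1), of 0] unfolding g_def
    by (auto intro!: derivative_eq_intros simp: k(2))
  then have g': "deriv g 0 = - deriv (deriv f) 0 / 2"
    by (simp add: DERIV_imp_deriv k(4))
  have "norm (g z) \<le> 21/2" if z: "norm z < 1" for z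
  proof -
    define R where "R = (1 + norm z) / 2"
    have R: "0 < R" "R < 1" "norm z < R"
      using z by (auto simp: R_def intro: add_pos_nonneg)
    then have sub: "cball 0 R \<subseteq> ball (0::complex) 1" by auto
    show ?thesis
    proof (rule maximum_modulus_frontier [where f = g and S = "cball 0 R"])
      show "g holomorphic_on interior (cball 0 R)"
        by (rule holomorphic_on_subset [OF holg]) (use R in auto)
      show "continuous_on (closure (cball 0 R)) g"
        by (rule continuous_on_subset [OF holomorphic_on_imp_continuous_on [OF holg]]) (use sub in auto)
      show "bounded (cball (0::complex) R)" "z \<in> cball 0 R" using R by auto
      show "norm (g w) \<le> 21/2" if "w \<in> frontier (cball 0 R)" for w
      proof -
        have w: "norm w = R" using that by auto
        have "R \<le> 21/2 * (R * norm (k w))"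
          using weak_Koebe_sphere [OF holf inj f0 f'0 R(1,2) w] k(3) [of w] w R by (simp add: norm_mult)
        then have "1 \<le> 21/2 * norm (k w)"
          using R by (simp add: mult.left_commute)
        then show ?thesis
          using knz [of w] w R by (simp add: g_def norm_divide field_simps)
      qed
    qed
  qed
  moreover have "f z * g z = z" if "norm z < 1" for z
    using k(3) [OF that] knz [OF that] by (simp add: g_def)
  ultimately show thesis
    using that [of g] holg g' k(2) by (simp add: g_def)
qed

section \<open>Koebe transforms and the class S\<close>

definition Koebe_transform :: "(complex \<Rightarrow> complex) \<Rightarrow> complex \<Rightarrow> complex \<Rightarrow> complex"
  where "Koebe_transform f a z =
    (f (Moebius_function 0 (- a) z) - f a) / (of_real (1 - (norm a)\<^sup>2) * deriv f a)"

text \<open>The Moebius map sends 0 to \<open>a\<close> and \<open>- a\<close> to 0, so the value at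
  \<open>- a\<close> captures \<open>f a / f' a\<close>, and the second derivative at 0 captures
  \<open>f'' a / f' a\<close>: the two ingredients of \<open>D f a\<close>.\<close>

lemma Koebe_transform:
  assumes "f \<in> class_S" and a: "norm a < 1"
  shows "Koebe_transform f a \<in> class_S"
    "Koebe_transform f a (- a) = - f a / (of_real (1 - (norm a)\<^sup>2) * deriv f a)"
    "deriv (deriv (Koebe_transform f a)) 0 = of_real (1 - (norm a)\<^sup>2) * (deriv (deriv f) a / deriv f a) - 2 * cnj a"
proof -
  have holf: "f holomorphic_on ball 0 1" and f0: "f 0 = 0" and inj: "inj_on f (ball 0 1)"
    using assms by (auto simp: class_S_def class_A_def)
  define s where "s = complex_of_real (1 - (norm a)\<^sup>2)"
  define M where "M = Moebius_function 0 (- a)"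
  define F where "F = Koebe_transform f a"
  have F: "F z = (f (M z) - f a) / (s * deriv f a)" for z
    by (simp add: F_def Koebe_transform_def M_def s_def)
  have f'a: "deriv f a \<noteq> 0"
    using holomorphic_injective_imp_regular [OF holf open_ball inj] a by simp
  have "(norm a)\<^sup>2 < 1" using a by (simp add: abs_square_less_1)
  then have "1 - (norm a)\<^sup>2 \<noteq> 0" by simp
  then have s: "s \<noteq> 0" unfolding s_def of_real_eq_0_iff .
  have M1: "norm (M z) < 1" if "norm z < 1" for z
    using Moebius_function_norm_lt_1 [of "- a" z 0] a that by (simp add: M_def)
  have nz: "1 + cnj a * z \<noteq> 0" if "norm z < 1" for z
    using one_minus_cnj_mult_nonzero [of "- a" z] a that by simp
  have dM: "(M has_field_derivative s / (1 + cnj a * z)\<^sup>2) (at z)" if "norm z < 1" for z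
    using Moebius_function_has_field_derivative [of "- a" z] nz [OF that] by (simp add: M_def s_def)
  have M0: "M 0 = a" "M (- a) = 0"
    by (simp_all add: M_def Moebius_function_simple)
  have df: "(f has_field_derivative deriv f z) (at z)" if "norm z < 1" for z
    using holomorphic_derivI [OF holf, of z] that by simp
  have dF: "(F has_field_derivative deriv f (M z) * (s / (1 + cnj a * z)\<^sup>2) / (s * deriv f a)) (at z)"
    if "norm z < 1" for z
  proof -
    have "((\<lambda>z. f (M z)) has_field_derivative deriv f (M z) * (s / (1 + cnj a * z)\<^sup>2)) (at z)"
      by (rule DERIV_chain2 [OF df [OF M1 [OF that]] dM [OF that]])
    from DERIV_cdivide [OF DERIV_diff [OF this DERIV_const [of "f a"]], of "s * deriv f a"]
    show ?thesis by (simp add: F [abs_def])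
  qed
  have F': "deriv F z = deriv f (M z) / (1 + cnj a * z)\<^sup>2 / deriv f a" if "norm z < 1" for z
    using DERIV_imp_deriv [OF dF [OF that]] s by simp
  have holF: "F holomorphic_on ball 0 1"
    unfolding holomorphic_on_open [OF open_ball] using dF by (meson mem_ball_0)
  have injM: "inj_on M (ball 0 1)"
  proof (rule inj_on_inverseI)
    fix z assume "z \<in> ball (0::complex) 1"
    then show "Moebius_function 0 a (M z) = z"
      unfolding M_def using Moebius_function_compose [of a "- a" z] a by simp
  qed
  have "inj_on F (ball 0 1)"
  proof (rule inj_onI)
    fix x y assume xy: "x \<in> ball 0 1" "y \<in> ball 0 1" and "F x = F y"
    then have "f (M x) = f (M y)" using s f'a by (simp add: F)
    then have "M x = M y"
      by (rule inj_onD [OF inj]) (use M1 xy in auto)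
    then show "x = y"
      by (rule inj_onD [OF injM]) (use xy in auto)
  qed
  moreover have "F 0 = 0" by (simp add: F M0)
  moreover have "deriv F 0 = 1" using F' [of 0] f'a by (simp add: M0)
  ultimately show "Koebe_transform f a \<in> class_S"
    using holF by (simp add: class_S_def class_A_def flip: F_def)
  show "Koebe_transform f a (- a) = - f a / (of_real (1 - (norm a)\<^sup>2) * deriv f a)"
    using F [of "- a"] by (simp add: F_def M0 f0 s_def)
  have df': "(deriv f has_field_derivative deriv (deriv f) a) (at (M 0))"
    unfolding M0 using holomorphic_derivI [OF holomorphic_deriv [OF holf open_ball] open_ball, of a] a by simp
  have "((\<lambda>z. deriv f (M z)) has_field_derivative deriv (deriv f) a * s) (at 0)"
    using DERIV_chain2 [OF df' dM [of 0]] by simp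
  then have "((\<lambda>z. deriv f (M z) / (1 + cnj a * z)\<^sup>2 / deriv f a) has_field_derivative
      (deriv (deriv f) a * s - deriv f a * (2 * cnj a)) / deriv f a) (at 0)"
    using f'a by (auto intro!: derivative_eq_intros simp: M0) (simp add: field_simps)
  then have "(deriv F has_field_derivative (deriv (deriv f) a * s - deriv f a * (2 * cnj a)) / deriv f a) (at 0)"
    by (rule has_field_derivative_transform_within_open [where S = "ball 0 1"]) (use F' in auto)
  then have "deriv (deriv F) 0 = (deriv (deriv f) a * s - deriv f a * (2 * cnj a)) / deriv f a"
    by (rule DERIV_imp_deriv)
  then show "deriv (deriv (Koebe_transform f a)) 0 = of_real (1 - (norm a)\<^sup>2) * (deriv (deriv f) a / deriv f a) - 2 * cnj a"
    using f'a by (simp add: F_def s_def diff_divide_distrib mult.commute)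
qed

lemma class_S_Re_D_pos:
  assumes "f \<in> class_S" and z: "norm z < 1/4"
  shows "Re (D f z) > 0"
proof (cases "z = 0")
  case True
  then show ?thesis by (simp add: D_def zf'_over_f_def)
next
  case False
  have z1: "norm z < 1" using z by simp
  have holf: "f holomorphic_on ball 0 1" and f0: "f 0 = 0" and inj: "inj_on f (ball 0 1)"
    using assms by (auto simp: class_S_def class_A_def)
  have f'z: "deriv f z \<noteq> 0"
    using holomorphic_injective_imp_regular [OF holf open_ball inj] z1 by simp
  have fz: "f z \<noteq> 0"
    using inj_onD [OF inj, of z 0] f0 z1 False by auto
  define r where "r = norm z"
  define s where "s = complex_of_real (1 - r\<^sup>2)"
  have r: "0 \<le> r" "r < 1/4" using z by (auto simp: r_def)
  have r2: "r\<^sup>2 < 1/16"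
    using power_strict_mono [OF r(2,1), of 2] by (simp add: power2_eq_square)
  have s: "s \<noteq> 0" unfolding s_def of_real_eq_0_iff using r2 by simp
  note K = Koebe_transform [OF assms(1) z1, folded r_def, folded s_def]
  obtain g where g: "g holomorphic_on ball 0 1" "g 0 = 1"
    "deriv g 0 = - deriv (deriv (Koebe_transform f z)) 0 / 2"
    "\<And>w. norm w < 1 \<Longrightarrow> Koebe_transform f z w * g w = w" "\<And>w. norm w < 1 \<Longrightarrow> norm (g w) \<le> 21/2"
    using class_S_reciprocal_bounded [OF K(1)] by metis
  define E where "E = g (- z) - g 0 - deriv g 0 * (- z)"
  have "norm E \<le> 21/2 * r\<^sup>2 / (1 - r)"
    using Taylor_remainder_bound [OF g(1,5), of "- z"] z1 by (simp add: E_def r_def)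
  \<comment> \<open>The value is \<open>7/8\<close>, below \<open>15/16 < 1 - r^2\<close>; this
    margin is what the constant \<open>21/2\<close> has to leave.\<close>
  also have "\<dots> \<le> (21/2 * (1/16)) / (3/4)"
    using r r2 by (intro frac_le) auto
  finally have E: "norm E \<le> 7/8" by simp
  have zc: "z * cnj z = of_real (r\<^sup>2)"
    unfolding r_def by (rule complex_norm_square [symmetric])
  have "- f z / (s * deriv f z) * g (- z) = - z"
    using g(4) [of "- z"] z1 K(2) by simp
  then have gz: "g (- z) = s * (z * deriv f z / f z)"
    using f'z fz s by (simp add: field_simps)
  have "s * (z * deriv (deriv f) z / deriv f z) = z * (deriv (deriv (Koebe_transform f z)) 0 + 2 * cnj z)"
    unfolding K(3) by (simp add: algebra_simps)
  also have "\<dots> = 2 * (of_real (r\<^sup>2) - z * deriv g 0)"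
    using zc by (simp add: g(3) algebra_simps)
  finally have "s * D f z = 2 * g (- z) - 2 * (of_real (r\<^sup>2) - z * deriv g 0)"
    using False by (simp add: D_def zf'_over_f_def gz algebra_simps)
  also have "\<dots> = 2 * (s + E)"
    by (simp add: E_def s_def g(2) algebra_simps)
  finally have "Re (s * D f z) = 2 * (1 - r\<^sup>2 + Re E)"
    by (simp add: s_def)
  moreover have "Re E \<ge> - (7/8)"
    using E abs_Re_le_cmod [of E] by linarith
  then have "2 * (1 - r\<^sup>2 + Re E) > 0" using r2 by simp
  ultimately have "Re (s * D f z) > 0" by (simp only:)
  then have "(1 - r\<^sup>2) * Re (D f z) > 0"
    unfolding s_def Re_complex_of_real times_complex.sel Im_complex_of_real by simp
  then show ?thesis using r2 by (simp add: zero_less_mult_iff)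
qed

section \<open>The radii of positivity\<close>

theorem theorem1:
  shows
    "(\<exists>r\<^sub>1::real. (\<forall>r::real. r^3 + 2 * r^2 - 2 = 0 \<longleftrightarrow> r = r\<^sub>1) \<and>
        0.839 \<le> r\<^sub>1 \<and> r\<^sub>1 < 0.840 \<and>
        (\<forall>f\<in>class_U. \<forall>z. norm z < r\<^sub>1 \<longrightarrow> Re (D f z) > 0)) \<and>
     (0.78615 \<le> sqrt ((sqrt 5 - 1) / 2) \<and> sqrt ((sqrt 5 - 1) / 2) < 0.78616 \<and>
        (\<forall>f\<in>class_starlike_half. \<forall>z. norm z < sqrt ((sqrt 5 - 1) / 2) \<longrightarrow> Re (D f z) > 0)) \<and>
     (\<forall>f\<in>class_G. \<forall>z. norm z < 2/3 \<longrightarrow> Re (D f z) > 0) \<and>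
     (\<forall>f\<in>class_starlike. \<forall>z. norm z < 1/2 \<longrightarrow> Re (D f z) > 0) \<and>
     (\<forall>f\<in>class_S. \<forall>z. norm z < 1/4 \<longrightarrow> Re (D f z) > 0)"
proof (intro conjI)
  obtain r1 :: real where r1: "\<And>r::real. r^3 + 2 * r^2 - 2 = 0 \<longleftrightarrow> r = r1" "0.839 \<le> r1" "r1 < 0.840"
    "\<And>r::real. 0 \<le> r \<Longrightarrow> r < r1 \<Longrightarrow> r^3 + 2 * r^2 < 2"
    using cubic_root by metis
  have "\<forall>f\<in>class_U. \<forall>z. norm z < r1 \<longrightarrow> Re (D f z) > 0"
    using r1(3,4) by (auto intro!: class_U_Re_D_pos)
  then show "\<exists>r\<^sub>1::real. (\<forall>r::real. r^3 + 2 * r^2 - 2 = 0 \<longleftrightarrow> r = r\<^sub>1) \<and>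
        0.839 \<le> r\<^sub>1 \<and> r\<^sub>1 < 0.840 \<and>
        (\<forall>f\<in>class_U. \<forall>z. norm z < r\<^sub>1 \<longrightarrow> Re (D f z) > 0)"
    using r1(1-3) by blast
  \<comment> \<open>The two bounds for \<open>sqrt 5\<close> are \<open>2 * 0.78615^2 + 1\<close>
    rounded up and \<open>2 * 0.78616^2 + 1\<close> rounded down.\<close>
  have "2.236064 \<le> sqrt 5"
    by (rule real_le_rsqrt) (simp add: power2_eq_square)
  then show "0.78615 \<le> sqrt ((sqrt 5 - 1) / 2)"
    by (intro real_le_rsqrt) (simp add: power2_eq_square)
  have "sqrt 5 < 2.236095"
    by (rule real_less_lsqrt) (simp_all add: power2_eq_square)
  then show "sqrt ((sqrt 5 - 1) / 2) < 0.78616"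
    by (intro real_less_lsqrt) (simp_all add: power2_eq_square)
qed (use class_starlike_half_Re_D_pos class_G_Re_D_pos class_starlike_Re_D_pos class_S_Re_D_pos in blast)+

end
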